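(* Let $G=(A,B,E)$ be a connected bipartite graph with $|A|\ge 2$ and $|B|\ge 2$. Then $\mathcal{B}(G)\le \eta(G)$, where $$\eta(G)=\max\Big\{\max_{u\in G}\big(\mathcal{D}(u,G)+\mathcal{C}(G)-2\big),\ \mathcal{M}(\Lambda(G))+\mathcal{R}(\Lambda(G))\Big\}.$$
   Context: All graphs are finite and undirected, with no self-loops and no multiple edges. $G=(A,B,E)$ is a bipartite graph with vertex classes $A$ and $B$. Two vertices $x,y$ are biconnected if they lie in the same connected component and still lie in the same connected component after deleting any single edge, or any single vertex other than $x$ and $y$. A vertex set is biconnected if every pair of its distinct vertices is biconnected. Consequently a single vertex is biconnected, while the two endpoints of a bridge are not biconnected. A block is the induced subgraph on a maximal biconnected vertex set; it is singular if it has exactly one vertex. $G$ is componentwise biconnected if every connected component is a block. A legal edge is a pair $(a,b)\in A\times B$ with $(a,b)\notin E$. A biconnector is a set $L$ of legal edges such that $(A,B,E\cup L)$ is componentwise biconnected. $\mathcal{B}(G)$ is the minimum size of a biconnector. A cut vertex is a vertex whose removal increases the number of connected components. A pendant block is either a singular block consisting of a vertex of degree $1$, or a nonsingular block containing exactly one cut vertex. $\Lambda(G)$ is the set of pendant blocks. A block is of type $A$ (resp. type $B$) if all its non-cut vertices lie in $A$ (resp. $B$). It is of type $AB$ if it has a non-cut vertex in $A$ and one in $B$. A legal pair is an unordered pair of two distinct pendant blocks with types $\{A,B\}$, $\{A,AB\}$, $\{B,AB\}$ or $\{AB,AB\}$. For $\Lambda'\subseteq\Lambda(G)$, a legal matching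 of $\Lambda'$ is a set of legal pairs of elements of $\Lambda'$ in which each element lies in at most one pair. $\mathcal{M}(\Lambda')$ is its maximum cardinality, and $\mathcal{R}(\Lambda')=|\Lambda'|-2\mathcal{M}(\Lambda')$. $\mathcal{D}(u,G)$ is the number of connected components of $X-\{u\}$, where $X$ is the component containing $u$. $\mathcal{C}(G)$ is the number of connected components of $G$ that are not blocks. *)

theory Defs
  imports Main
begin

text \<open>
  A graph is given by a vertex set \<open>V\<close> and a set \<open>E\<close> of pairs. Orientation of the pairs is ignored,
  and pairs with an endpoint outside \<open>V\<close> are ignored as well, so that replacing \<open>V\<close> by a subset
  gives the induced subgraph. For a bipartite graph \<open>(A, B, E)\<close> every edge is stored exactly
  once, as a pair in \<open>A \<times> B\<close>, so \<open>E - {e}\<close> really deletes the edge \<open>e\<close>.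
\<close>

definition bipartite_graph :: "'a set \<Rightarrow> 'a set \<Rightarrow> ('a \<times> 'a) set \<Rightarrow> bool" where
  "bipartite_graph A B E \<longleftrightarrow> finite A \<and> finite B \<and> A \<inter> B = {} \<and> E \<subseteq> A \<times> B"

definition same_component :: "'a set \<Rightarrow> ('a \<times> 'a) set \<Rightarrow> ('a \<times> 'a) set" where
  "same_component V E = {(x, y). x \<in> V \<and> y \<in> V \<and> (x, y) \<in> ((E \<union> E\<inverse>) \<inter> V \<times> V)\<^sup>*}"

definition components :: "'a set \<Rightarrow> ('a \<times> 'a) set \<Rightarrow> 'a set set" where
  "components V E = V // same_component V E"

definition connected_graph :: "'a set \<Rightarrow> ('a \<times> 'a) set \<Rightarrow> bool" where
  "connected_graph V E \<longleftrightarrow> V \<noteq> {} \<and> (\<forall>x\<in>V. \<forall>y\<in>V. (x, y) \<in> same_component V E)"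

definition biconnected :: "'a set \<Rightarrow> ('a \<times> 'a) set \<Rightarrow> 'a \<Rightarrow> 'a \<Rightarrow> bool" where
  "biconnected V E x y \<longleftrightarrow>
     (x, y) \<in> same_component V E \<and>
     (\<forall>e\<in>E. (x, y) \<in> same_component V (E - {e})) \<and>
     (\<forall>z\<in>V - {x, y}. (x, y) \<in> same_component (V - {z}) E)"

definition biconnected_set :: "'a set \<Rightarrow> ('a \<times> 'a) set \<Rightarrow> 'a set \<Rightarrow> bool" where
  "biconnected_set V E S \<longleftrightarrow> S \<subseteq> V \<and> (\<forall>x\<in>S. \<forall>y\<in>S. x \<noteq> y \<longrightarrow> biconnected V E x y)"

text \<open>Blocks are induced subgraphs, hence determined by, and identified with, their vertex sets.\<close>

definition block :: "'a set \<Rightarrow> ('a \<times> 'a) set \<Rightarrow> 'a set \<Rightarrow> bool" where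
  "block V E S \<longleftrightarrow> biconnected_set V E S \<and> (\<forall>T. biconnected_set V E T \<and> S \<subseteq> T \<longrightarrow> T = S)"

definition componentwise_biconnected :: "'a set \<Rightarrow> ('a \<times> 'a) set \<Rightarrow> bool" where
  "componentwise_biconnected V E \<longleftrightarrow> (\<forall>X\<in>components V E. block V E X)"

definition biconnector :: "'a set \<Rightarrow> 'a set \<Rightarrow> ('a \<times> 'a) set \<Rightarrow> ('a \<times> 'a) set \<Rightarrow> bool" where
  "biconnector A B E L \<longleftrightarrow> L \<subseteq> A \<times> B - E \<and> componentwise_biconnected (A \<union> B) (E \<union> L)"

text \<open>
  The minimum exists whenever both sides have at least two vertices, because then the complete
  bipartite graph is biconnected; otherwise the set may be empty and \<open>Min\<close> is unspecified.
\<close>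

definition min_biconnector_size :: "'a set \<Rightarrow> 'a set \<Rightarrow> ('a \<times> 'a) set \<Rightarrow> nat" where
  "min_biconnector_size A B E = Min (card ` {L. biconnector A B E L})"

definition cut_vertex :: "'a set \<Rightarrow> ('a \<times> 'a) set \<Rightarrow> 'a \<Rightarrow> bool" where
  "cut_vertex V E v \<longleftrightarrow> v \<in> V \<and> card (components (V - {v}) E) > card (components V E)"

definition degree :: "'a set \<Rightarrow> ('a \<times> 'a) set \<Rightarrow> 'a \<Rightarrow> nat" where
  "degree V E v = card {w \<in> V. (v, w) \<in> E \<union> E\<inverse>}"

definition pendant_blocks :: "'a set \<Rightarrow> ('a \<times> 'a) set \<Rightarrow> 'a set set" where
  "pendant_blocks V E = {S. block V E S \<and>
     ((\<exists>v. S = {v} \<and> degree V E v = 1) \<or>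
      (card S \<noteq> 1 \<and> card {c \<in> S. cut_vertex V E c} = 1))}"

definition type_A :: "'a set \<Rightarrow> 'a set \<Rightarrow> ('a \<times> 'a) set \<Rightarrow> 'a set \<Rightarrow> bool" where
  "type_A A B E S \<longleftrightarrow> (\<forall>v\<in>S. \<not> cut_vertex (A \<union> B) E v \<longrightarrow> v \<in> A)"

definition type_B :: "'a set \<Rightarrow> 'a set \<Rightarrow> ('a \<times> 'a) set \<Rightarrow> 'a set \<Rightarrow> bool" where
  "type_B A B E S \<longleftrightarrow> (\<forall>v\<in>S. \<not> cut_vertex (A \<union> B) E v \<longrightarrow> v \<in> B)"

definition type_AB :: "'a set \<Rightarrow> 'a set \<Rightarrow> ('a \<times> 'a) set \<Rightarrow> 'a set \<Rightarrow> bool" where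
  "type_AB A B E S \<longleftrightarrow>
     (\<exists>v\<in>S. \<not> cut_vertex (A \<union> B) E v \<and> v \<in> A) \<and>
     (\<exists>v\<in>S. \<not> cut_vertex (A \<union> B) E v \<and> v \<in> B)"

definition legal_pairs :: "'a set \<Rightarrow> 'a set \<Rightarrow> ('a \<times> 'a) set \<Rightarrow> 'a set set set" where
  "legal_pairs A B E = {{P, Q} | P Q.
     P \<in> pendant_blocks (A \<union> B) E \<and> Q \<in> pendant_blocks (A \<union> B) E \<and> P \<noteq> Q \<and>
     (type_A A B E P \<and> type_B A B E Q \<or>
      type_A A B E P \<and> type_AB A B E Q \<or>
      type_B A B E P \<and> type_AB A B E Q \<or>
      type_AB A B E P \<and> type_AB A B E Q)}"

definition legal_matching ::
  "'a set \<Rightarrow> 'a set \<Rightarrow> ('a \<times> 'a) set \<Rightarrow> 'a set set \<Rightarrow> 'a set set set \<Rightarrow> bool" where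
  "legal_matching A B E \<Lambda> M \<longleftrightarrow>
     M \<subseteq> legal_pairs A B E \<and> (\<forall>p\<in>M. p \<subseteq> \<Lambda>) \<and>
     (\<forall>P\<in>\<Lambda>. \<forall>p\<in>M. \<forall>q\<in>M. P \<in> p \<and> P \<in> q \<longrightarrow> p = q)"

definition max_matching :: "'a set \<Rightarrow> 'a set \<Rightarrow> ('a \<times> 'a) set \<Rightarrow> 'a set set \<Rightarrow> nat" where
  "max_matching A B E \<Lambda> = Max (card ` {M. legal_matching A B E \<Lambda> M})"

definition unmatched :: "'a set \<Rightarrow> 'a set \<Rightarrow> ('a \<times> 'a) set \<Rightarrow> 'a set set \<Rightarrow> int" where
  "unmatched A B E \<Lambda> = int (card \<Lambda>) - 2 * int (max_matching A B E \<Lambda>)"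

definition split_number :: "'a set \<Rightarrow> ('a \<times> 'a) set \<Rightarrow> 'a \<Rightarrow> nat" where
  "split_number V E u = card (components (same_component V E `` {u} - {u}) E)"

definition nonblock_components :: "'a set \<Rightarrow> ('a \<times> 'a) set \<Rightarrow> nat" where
  "nonblock_components V E = card {X \<in> components V E. \<not> block V E X}"

text \<open>
  In \<open>\<D>(u, G)\<close>, \<open>\<C>(G)\<close>, \<open>\<M>(\<Lambda>)\<close>, \<open>\<R>(\<Lambda>)\<close> notation, the functions \<open>split_number\<close>,
  \<open>nonblock_components\<close>, \<open>max_matching\<close> and \<open>unmatched\<close> occur below in this order.
  The first maximum is taken over the integers: a biconnected graph contributes \<open>1 + 0 - 2 = - 1\<close>.
\<close>

definition eta :: "'a set \<Rightarrow> 'a set \<Rightarrow> ('a \<times> 'a) set \<Rightarrow> int" where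
  "eta A B E = max
     (Max ((\<lambda>u. int (split_number (A \<union> B) E u) + int (nonblock_components (A \<union> B) E) - 2) ` (A \<union> B)))
     (int (max_matching A B E (pendant_blocks (A \<union> B) E)) +
      unmatched A B E (pendant_blocks (A \<union> B) E))"

end

theory Submission
  imports Defs
begin

text \<open>
  It suffices to find \<open>k = \<eta>(G)\<close> pairs \<open>(a\<^sub>i, b\<^sub>i)\<close> whose addition keeps the graph connected after
  deleting any vertex. Call a component of some \<open>G - v\<close>, \<open>v\<close> a cut vertex, an end if it is minimal
  among all of these; ends consist of non-cut vertices and correspond to pendant blocks, so by
  counting a legal matching, endpoints can be chosen that hit every end. Among all ways of
  arranging these endpoints into pairs take one that connects as many pairs of vertices as possible,
  summed over all vertex deletions. If some \<open>G + L - v\<close> were still disconnected, then, since \<open>G - v\<close>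
  has at most \<open>k + 1\<close> components, some pair is redundant there, and exchanging its partner with that
  of a pair from another component joins the two components, while for every \<open>u \<noteq> v\<close> nothing is lost:
  at least one of the two pairs lies in the component of \<open>G - u\<close> containing \<open>v\<close>. If all vertices of
  one side are cut vertices, then all ends are leaves on the other side, and the partners of these
  leaves may be rearranged freely.
\<close>

section \<open>Connectivity\<close>

lemma equiv_same_component: "equiv V (same_component V E)"
proof -
  have "sym ((E \<union> E\<inverse>) \<inter> V \<times> V)" by (auto simp: sym_def)
  then have "sym (((E \<union> E\<inverse>) \<inter> V \<times> V)\<^sup>*)" by (rule sym_rtrancl)
  moreover have "trans (((E \<union> E\<inverse>) \<inter> V \<times> V)\<^sup>*)" by (rule trans_rtrancl)
  ultimately show ?thesis
    unfolding same_component_def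
    by (intro equivI refl_onI symI transI) (auto dest: symD transD)
qed

lemma same_component_refl: "x \<in> V \<Longrightarrow> (x, x) \<in> same_component V E"
  by (simp add: same_component_def)

lemma same_component_sym: "(x, y) \<in> same_component V E \<Longrightarrow> (y, x) \<in> same_component V E"
  using equiv_same_component[of V E] by (meson equivE symD)

lemma same_component_trans:
  "(x, y) \<in> same_component V E \<Longrightarrow> (y, z) \<in> same_component V E \<Longrightarrow> (x, z) \<in> same_component V E"
  using equiv_same_component[of V E] by (meson equivE transD)

lemma same_component_join:
  "(x, z) \<in> same_component V E \<Longrightarrow> (y, z) \<in> same_component V E \<Longrightarrow> (x, y) \<in> same_component V E"
  using same_component_sym same_component_trans by metis

lemma same_component_mem: "(x, y) \<in> same_component V E \<Longrightarrow> x \<in> V \<and> y \<in> V"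
  by (simp add: same_component_def)

lemma same_component_edge:
  "(x, y) \<in> E \<or> (y, x) \<in> E \<Longrightarrow> x \<in> V \<Longrightarrow> y \<in> V \<Longrightarrow> (x, y) \<in> same_component V E"
  by (auto simp: same_component_def)

lemma same_component_induct [consumes 1, case_names base step]:
  assumes "(x, y) \<in> same_component V E"
    and "P x"
    and "\<And>y z. (x, y) \<in> same_component V E \<Longrightarrow> y \<in> V \<Longrightarrow> z \<in> V \<Longrightarrow> (y, z) \<in> E \<or> (z, y) \<in> E \<Longrightarrow> P y \<Longrightarrow> P z"
  shows "P y"
proof -
  from assms(1) have x: "x \<in> V" and r: "(x, y) \<in> ((E \<union> E\<inverse>) \<inter> V \<times> V)\<^sup>*"
    by (auto simp: same_component_def)
  from r have "(x, y) \<in> same_component V E \<and> P y"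
  proof (induction rule: rtrancl_induct)
    case base
    then show ?case using x assms(2) by (simp add: same_component_refl)
  next
    case (step y z)
    then show ?case
      using assms(3)[of y z] same_component_edge[of y z E V] same_component_trans[of x y V E z] by blast
  qed
  then show ?thesis by simp
qed

text \<open>A walk survives a change of graph as soon as each of its edges can be replaced by a
  walk. This reduces every later comparison of two graphs to the few edges that were lost.\<close>

lemma same_component_subset:
  assumes "\<And>p q. (p, q) \<in> E \<Longrightarrow> p \<in> V \<Longrightarrow> q \<in> V \<Longrightarrow> (p, q) \<in> same_component W F" and "V \<subseteq> W"
  shows "same_component V E \<subseteq> same_component W F"
proof safe
  fix x y assume xy: "(x, y) \<in> same_component V E"
  then have x: "x \<in> W" using assms(2) same_component_mem by fast
  from xy show "(x, y) \<in> same_component W F"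
  proof (induction rule: same_component_induct)
    case base
    show ?case using x by (rule same_component_refl)
  next
    case (step y z)
    then show ?case using assms(1) same_component_sym same_component_trans by metis
  qed
qed

lemma same_component_mono:
  "V \<subseteq> W \<Longrightarrow> E \<subseteq> F \<Longrightarrow> same_component V E \<subseteq> same_component W F"
  by (rule same_component_subset) (auto intro: same_component_edge)

text \<open>Only the symmetric closure matters; this later allows the two sides of the graph to
  exchange their roles.\<close>

lemma same_component_converse: "same_component V (E \<union> F\<inverse>) = same_component V (E \<union> F)"
proof -
  have "(E \<union> F\<inverse>) \<union> (E \<union> F\<inverse>)\<inverse> = (E \<union> F) \<union> (E \<union> F)\<inverse>" by auto
  then show ?thesis by (simp add: same_component_def)
qed

lemma finite_components: "finite V \<Longrightarrow> finite (components V E)"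
  unfolding components_def
  by (rule finite_quotient) (auto simp: same_component_def)

lemma component_of_mem: "x \<in> V \<Longrightarrow> same_component V E `` {x} \<in> components V E"
  by (auto simp: components_def quotient_def)

lemma componentE:
  assumes "C \<in> components V E"
  obtains x where "x \<in> V" "C = same_component V E `` {x}"
  using assms by (auto simp: components_def quotient_def)

lemma component_iff:
  "C \<in> components V E \<Longrightarrow> x \<in> C \<Longrightarrow> y \<in> C \<longleftrightarrow> (x, y) \<in> same_component V E"
  by (auto elim!: componentE dest: same_component_sym intro: same_component_trans)

lemma component_subset: "C \<in> components V E \<Longrightarrow> C \<subseteq> V"
  by (auto elim!: componentE dest: same_component_mem)

lemma component_nonempty: "C \<in> components V E \<Longrightarrow> C \<noteq> {}"
  by (auto elim!: componentE intro: same_component_refl)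

lemma components_connected:
  "connected_graph V E \<Longrightarrow> components V E = {V}"
proof -
  assume c: "connected_graph V E"
  then have "same_component V E `` {x} = V" if "x \<in> V" for x
    using that by (auto simp: connected_graph_def dest: same_component_mem)
  with c show ?thesis by (auto simp: components_def quotient_def connected_graph_def)
qed

lemma same_component_if_card_components_le_1:
  assumes "finite V" "card (components V E) \<le> 1" "x \<in> V" "y \<in> V"
  shows "(x, y) \<in> same_component V E"
proof -
  have "same_component V E `` {x} = same_component V E `` {y}"
    using assms finite_components[of V E] component_of_mem
    by (metis One_nat_def card_le_Suc0_iff_eq)
  then show ?thesis using assms same_component_refl by fast
qed

text \<open>A connected graph has exactly one component, so the increase in the count means that at
  least two components remain, that is, that some two remaining vertices are separated.\<close>

lemma cut_vertex_iff:
  assumes "finite V" "connected_graph V E" "v \<in> V"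
  shows "cut_vertex V E v \<longleftrightarrow> (\<exists>x\<in>V - {v}. \<exists>y\<in>V - {v}. (x, y) \<notin> same_component (V - {v}) E)"
proof -
  have cut: "cut_vertex V E v \<longleftrightarrow> \<not> card (components (V - {v}) E) \<le> 1"
    using assms by (simp add: cut_vertex_def components_connected) linarith
  have "card (components (V - {v}) E) \<le> 1"
    if all: "\<forall>x\<in>V - {v}. \<forall>y\<in>V - {v}. (x, y) \<in> same_component (V - {v}) E"
  proof -
    have "C = D" if "C \<in> components (V - {v}) E" "D \<in> components (V - {v}) E" for C D
    proof -
      have eq: "X = V - {v}" if "X \<in> components (V - {v}) E" for X
        using that all component_nonempty[OF that] component_subset[OF that] component_iff[OF that]
        by blast
      then show ?thesis using eq[OF that(1)] eq[OF that(2)] by simp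
    qed
    then show ?thesis
      using assms(1) by (simp add: card_le_Suc0_iff_eq finite_components)
  qed
  moreover have "(x, y) \<in> same_component (V - {v}) E"
    if "card (components (V - {v}) E) \<le> 1" "x \<in> V - {v}" "y \<in> V - {v}" for x y
    using that assms(1) by (intro same_component_if_card_components_le_1) auto
  ultimately show ?thesis unfolding cut by blast
qed

text \<open>Until a walk from \<open>x\<close> first meets \<open>v\<close>, it stays in the
  component of \<open>G - v\<close> containing \<open>x\<close>, which misses \<open>u\<close>. That
  initial part of the walk therefore reaches \<open>v\<close> without using
  \<open>u\<close>.\<close>

lemma same_component_separator:
  assumes "connected_graph V E" "u \<in> V" "v \<in> V" "u \<noteq> v" "x \<in> V"
    and sep: "(x, u) \<notin> same_component (V - {v}) E"
  shows "(x, v) \<in> same_component (V - {u}) E"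
proof (cases "x = v")
  case True
  then show ?thesis using assms by (auto intro: same_component_refl)
next
  case False
  have xu: "x \<noteq> u" using sep assms False by (auto intro: same_component_refl)
  have xv: "(x, v) \<in> same_component V E" using assms by (auto simp: connected_graph_def)
  \<comment> \<open>Invariant along the walk: either \<open>v\<close> can be reached without
    \<open>u\<close>, or the current vertex \<open>w\<close> is joined to \<open>x\<close> both
    without \<open>v\<close> and without \<open>u\<close>.\<close>
  have "(x, v) \<in> same_component (V - {u}) E \<or>
    (x, w) \<in> same_component (V - {v}) E \<inter> same_component (V - {u}) E"
    if "(x, w) \<in> same_component V E" for w
    using that
  proof (induction rule: same_component_induct)
    case base
    then show ?case using False xu assms by (auto intro: same_component_refl)
  next
    case (step y z)
    show ?case
    proof (cases "(x, v) \<in> same_component (V - {u}) E")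
      case False
      with step have y: "(x, y) \<in> same_component (V - {v}) E" "(x, y) \<in> same_component (V - {u}) E"
        by auto
      have yu: "y \<in> V - {u}" "y \<in> V - {v}" using y same_component_mem by fast+
      show ?thesis
      proof (cases "z = v")
        case True
        then have "(y, v) \<in> same_component (V - {u}) E"
          using step yu assms by (intro same_component_edge) auto
        then show ?thesis using y(2) same_component_trans by fast
      next
        case zv: False
        then have "(y, z) \<in> same_component (V - {v}) E"
          using step yu by (intro same_component_edge) auto
        then have xz: "(x, z) \<in> same_component (V - {v}) E" using y(1) same_component_trans by fast
        then have "z \<noteq> u" using sep by auto
        then have "(y, z) \<in> same_component (V - {u}) E"
          using step yu by (intro same_component_edge) auto
        then show ?thesis using xz y(2) same_component_trans by fast
      qed
    qed simp
  qed
  from this[OF xv] show ?thesis by (auto dest: same_component_mem)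
qed

text \<open>Sending each old component to the new one containing it is surjective, but not
  injective, because the components of \<open>x\<close> and \<open>y\<close> have the same
  image.\<close>

lemma card_components_insert_edge:
  assumes "finite V" "x \<in> V" "y \<in> V" "(x, y) \<notin> same_component V E"
  shows "card (components V (insert (x, y) E)) < card (components V E)"
proof -
  let ?R = "same_component V E" and ?S = "same_component V (insert (x, y) E)"
  let ?f = "\<lambda>C. ?S `` C"
  have sub: "?R \<subseteq> ?S" by (rule same_component_mono) auto
  have f: "?f (?R `` {z}) = ?S `` {z}" if "z \<in> V" for z
    using sub that by (auto intro: same_component_trans same_component_refl)
  have quot: "components V F = (\<lambda>z. same_component V F `` {z}) ` V" for F
    by (auto simp: components_def quotient_def)
  have img: "components V (insert (x, y) E) = ?f ` components V E"
    unfolding quot image_image using f by (intro image_cong) auto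
  have "(x, y) \<in> ?S" using assms by (intro same_component_edge) auto
  then have "?S `` {x} = ?S `` {y}" by (meson equiv_class_eq equiv_same_component)
  moreover have "?R `` {x} \<noteq> ?R `` {y}"
    using assms same_component_refl by fast
  ultimately have "\<not> inj_on ?f (components V E)"
    using f assms component_of_mem[of _ V E] unfolding inj_on_def by metis
  then show ?thesis
    unfolding img using assms(1) finite_components eq_card_imp_inj_on card_image_le le_neq_implies_less
    by metis
qed

section \<open>Exchanging new edges\<close>

definition pairing :: "nat \<Rightarrow> (nat \<Rightarrow> 'a) \<Rightarrow> (nat \<Rightarrow> 'a) \<Rightarrow> ('a \<times> 'a) set" where
  "pairing k a b = (\<lambda>i. (a i, b i)) ` {..<k}"

text \<open>The potential to be maximised. Keeping the triples as a set allows an improvement to be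
  stated as strict inclusion: nothing lost at any deleted vertex, something gained at one.\<close>

definition linked :: "'a set \<Rightarrow> ('a \<times> 'a) set \<Rightarrow> ('a \<times> 'a \<times> 'a) set" where
  "linked V E = {(u, x, y). u \<in> V \<and> (x, y) \<in> same_component (V - {u}) E}"

lemma linked_subset: "linked V E \<subseteq> V \<times> V \<times> V"
  by (auto simp: linked_def dest: same_component_mem)

lemma linked_psubset:
  assumes "\<And>u. u \<in> V \<Longrightarrow> same_component (V - {u}) E \<subseteq> same_component (V - {u}) F"
    and "v \<in> V" "(x, y) \<in> same_component (V - {v}) F" "(x, y) \<notin> same_component (V - {v}) E"
  shows "linked V E \<subset> linked V F"
proof -
  have "(v, x, y) \<in> linked V F" "(v, x, y) \<notin> linked V E" using assms by (auto simp: linked_def)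
  moreover have "linked V E \<subseteq> linked V F" using assms(1) by (fastforce simp: linked_def)
  ultimately show ?thesis by blast
qed

text \<open>If no pair were redundant, adding the pairs one at a time would merge two components
  each time, and \<open>k\<close> merges turn at most \<open>k + 1\<close> components into one.
  Redundancy refers to indices, so a pair that occurs twice counts as redundant.\<close>

lemma redundant_pair_exists:
  assumes "finite V" "card (components V E) \<le> k + 1"
    and mem: "\<And>i. i < k \<Longrightarrow> a i \<in> V \<and> b i \<in> V"
    and "x \<in> V" "y \<in> V" "(x, y) \<notin> same_component V (E \<union> pairing k a b)"
  shows "\<exists>i<k. (a i, b i) \<in> same_component V (E \<union> (\<lambda>l. (a l, b l)) ` ({..<k} - {i}))"
proof (rule ccontr)
  assume "\<not> ?thesis"
  then have bridge: "(a i, b i) \<notin> same_component V (E \<union> (\<lambda>l. (a l, b l)) ` ({..<k} - {i}))"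
    if "i < k" for i using that by blast
  have "m \<le> k \<Longrightarrow> card (components V (E \<union> pairing m a b)) + m \<le> card (components V E)" for m
  proof (induction m)
    case 0
    then show ?case by (simp add: pairing_def)
  next
    case (Suc m)
    have "pairing m a b \<subseteq> (\<lambda>l. (a l, b l)) ` ({..<k} - {m})"
      using Suc.prems by (auto simp: pairing_def)
    then have "same_component V (E \<union> pairing m a b)
        \<subseteq> same_component V (E \<union> (\<lambda>l. (a l, b l)) ` ({..<k} - {m}))"
      by (intro same_component_mono) auto
    then have "(a m, b m) \<notin> same_component V (E \<union> pairing m a b)"
      using bridge[of m] Suc.prems by auto
    then have "card (components V (insert (a m, b m) (E \<union> pairing m a b)))
        < card (components V (E \<union> pairing m a b))"
      using assms(1) mem[of m] Suc.prems by (intro card_components_insert_edge) auto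
    moreover have "insert (a m, b m) (E \<union> pairing m a b) = E \<union> pairing (Suc m) a b"
      by (auto simp: pairing_def lessThan_Suc)
    ultimately show ?case using Suc by simp
  qed
  from this[of k] have "card (components V (E \<union> pairing k a b)) \<le> 1" using assms(2) by simp
  then show False using assms same_component_if_card_components_le_1 by metis
qed

text \<open>Crossing partners joins the component of a redundant pair \<open>i\<close> to that of a
  pair \<open>j\<close> elsewhere. For a deleted vertex \<open>u\<close> other than
  \<open>v\<close>, at most one of the two pairs shares with \<open>u\<close> a component of the
  augmented graph without \<open>v\<close>. Both ends of the other pair reach \<open>v\<close> in
  \<open>E\<close> without \<open>u\<close>, so that pair stays connected, and through it the
  crossed edges reconnect the first.\<close>

lemma swap_improves:
  assumes "finite V" "connected_graph V E" "v \<in> V"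
    and few: "card (components (V - {v}) E) \<le> k + 1"
    and mem: "\<And>i. i < k \<Longrightarrow> a i \<in> V - {v} \<and> b i \<in> V - {v}"
    and hit: "\<And>C. C \<in> components (V - {v}) E \<Longrightarrow> C \<inter> (a ` {..<k} \<union> b ` {..<k}) \<noteq> {}"
    and xy: "x \<in> V - {v}" "y \<in> V - {v}" "(x, y) \<notin> same_component (V - {v}) (E \<union> pairing k a b)"
  shows "\<exists>i<k. \<exists>j<k. linked V (E \<union> pairing k a b)
           \<subset> linked V (E \<union> pairing k a (b(i := b j, j := b i)))"
proof -
  let ?F = "E \<union> pairing k a b"
  let ?R = "\<lambda>u. same_component (V - {u}) ?F"
  obtain i where i: "i < k"
    and red: "(a i, b i) \<in> same_component (V - {v}) (E \<union> (\<lambda>l. (a l, b l)) ` ({..<k} - {i}))"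
    using redundant_pair_exists[of "V - {v}" E k a b x y] assms by blast
  have E_R: "same_component (V - {u}) E \<subseteq> ?R u" for u by (rule same_component_mono) auto
  have ab: "(a l, b l) \<in> ?R v" if "l < k" for l
    using that mem by (intro same_component_edge) (auto simp: pairing_def)
  obtain z where z: "z \<in> V - {v}" "(a i, z) \<notin> ?R v"
    using xy same_component_sym same_component_trans by metis
  \<comment> \<open>The component of \<open>z\<close> in \<open>G - v\<close> contains an endpoint
    of some pair; as the pair itself is an edge here, its \<open>a\<close>-end can be taken.\<close>
  obtain j where j: "j < k" "(a i, a j) \<notin> ?R v"
  proof -
    obtain l where l: "l < k" "(z, a l) \<in> same_component (V - {v}) E \<or> (z, b l) \<in> same_component (V - {v}) E"
      using hit[OF component_of_mem[OF z(1)]] by auto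
    then have "(z, a l) \<in> ?R v \<or> (z, b l) \<in> ?R v" using E_R[of v] by blast
    then have "(z, a l) \<in> ?R v"
      using same_component_trans[OF _ same_component_sym[OF ab[OF l(1)]]] by blast
    then have "(a i, a l) \<notin> ?R v" using z same_component_sym same_component_trans by metis
    then show ?thesis using that l by blast
  qed
  have ij: "i \<noteq> j" using j mem[OF i] by (auto intro: same_component_refl)
  let ?b = "b(i := b j, j := b i)"
  let ?F' = "E \<union> pairing k a ?b"
  let ?R' = "\<lambda>u. same_component (V - {u}) ?F'"
  have E_R': "same_component (V - {u}) E \<subseteq> ?R' u" for u by (rule same_component_mono) auto
  have new: "(a i, b j) \<in> ?F'" "(a j, b i) \<in> ?F'"
    using i j(1) ij by (force simp: pairing_def)+
  have old: "(p, q) \<in> ?F' \<or> (p, q) = (a i, b i) \<or> (p, q) = (a j, b j)" if "(p, q) \<in> ?F" for p q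
    using that by (force simp: pairing_def)
  \<comment> \<open>Only the pairs \<open>i\<close> and \<open>j\<close> can disappear, so it
    suffices to reconnect their ends.\<close>
  have mono: "?R u \<subseteq> ?R' u"
    if "a i \<in> V - {u} \<Longrightarrow> b i \<in> V - {u} \<Longrightarrow> (a i, b i) \<in> ?R' u"
      and "a j \<in> V - {u} \<Longrightarrow> b j \<in> V - {u} \<Longrightarrow> (a j, b j) \<in> ?R' u" for u
  proof (rule same_component_subset)
    fix p q assume pq: "(p, q) \<in> ?F" "p \<in> V - {u}" "q \<in> V - {u}"
    from old[OF pq(1)] show "(p, q) \<in> ?R' u"
    proof (elim disjE)
      assume "(p, q) \<in> ?F'"
      then show ?thesis using pq by (intro same_component_edge) auto
    qed (use that pq in auto)
  qed simp
  have edge_ij: "(a i, b j) \<in> ?R' u" if "a i \<in> V - {u}" "b j \<in> V - {u}" for u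
    using new that by (intro same_component_edge) auto
  have edge_ji: "(a j, b i) \<in> ?R' u" if "a j \<in> V - {u}" "b i \<in> V - {u}" for u
    using new that by (intro same_component_edge) auto
  have sep: "(p, v) \<in> same_component (V - {u}) E" if "u \<in> V" "u \<noteq> v" "p \<in> V" "(p, u) \<notin> ?R v" for p u
    using same_component_separator[OF assms(2) that(1) _ that(2,3)] that E_R[of v] assms by blast
  have away: "(a l, b l) \<in> ?R' u \<and> a l \<in> V - {u} \<and> b l \<in> V - {u}"
    if "l < k" "u \<in> V" "u \<noteq> v" "(a l, u) \<notin> ?R v" for l u
  proof -
    have "(b l, u) \<notin> ?R v" using that ab same_component_trans by metis
    then have "(a l, v) \<in> same_component (V - {u}) E" "(b l, v) \<in> same_component (V - {u}) E"
      using that mem[OF that(1)] by (auto intro!: sep)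
    then have "(a l, b l) \<in> same_component (V - {u}) E"
      using same_component_sym same_component_trans by metis
    then show ?thesis using E_R' same_component_mem by fast
  qed
  have other: "?R u \<subseteq> ?R' u" if u: "u \<in> V" "u \<noteq> v" for u
  proof (cases "(a i, u) \<in> ?R v")
    case False
    note w = away[OF i u False]
    show ?thesis
    proof (rule mono)
      assume "a j \<in> V - {u}" "b j \<in> V - {u}"
      then show "(a j, b j) \<in> ?R' u"
        using w edge_ij edge_ji same_component_sym same_component_trans by metis
    qed (use w in auto)
  next
    case True
    then have "(a j, u) \<notin> ?R v" using j same_component_sym same_component_trans by metis
    note w = away[OF j(1) u this]
    show ?thesis
    proof (rule mono)
      assume "a i \<in> V - {u}" "b i \<in> V - {u}"
      then show "(a i, b i) \<in> ?R' u"
        using w edge_ij edge_ji same_component_sym same_component_trans by metis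
    qed (use w in auto)
  qed
  \<comment> \<open>The pair \<open>j\<close> lies in another component, so the connection making the pair \<open>i\<close> redundant
    does not use it.\<close>
  have ai: "(a i, b i) \<in> ?R' v"
  proof -
    let ?G = "E \<union> (\<lambda>l. (a l, b l)) ` ({..<k} - {i})"
    have sub: "same_component (V - {v}) ?G \<subseteq> ?R v"
      by (rule same_component_mono) (auto simp: pairing_def)
    have "(a i, w) \<in> ?R' v" if "(a i, w) \<in> same_component (V - {v}) ?G" for w
      using that
    proof (induction rule: same_component_induct)
      case base
      show ?case using mem[OF i] by (intro same_component_refl) auto
    next
      case (step y z)
      have "(a i, y) \<in> ?R v" using step(1) sub by blast
      moreover have "(a i, b j) \<notin> ?R v"
        using j(2) same_component_trans[OF _ same_component_sym[OF ab[OF j(1)]]] by blast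
      ultimately have ne: "y \<noteq> a j" "y \<noteq> b j" using j(2) by auto
      have "(y, z) \<in> ?F' \<or> (z, y) \<in> ?F'"
      proof -
        have "(p, q) \<in> ?F'" if "(p, q) \<in> ?G" "p \<noteq> a j \<or> q \<noteq> b j" for p q
          using that by (force simp: pairing_def)
        then show ?thesis using step ne by blast
      qed
      then have "(y, z) \<in> ?R' v" using step by (intro same_component_edge) auto
      then show ?case using step(5) by (blast intro: same_component_trans)
    qed
    then show ?thesis using red .
  qed
  have ij_v: "(a i, b j) \<in> ?R' v" and ji_v: "(a j, b i) \<in> ?R' v"
    using edge_ij edge_ji mem[OF i] mem[OF j(1)] by auto
  have aj': "(a i, a j) \<in> ?R' v"
    using ai same_component_sym[OF ji_v] by (rule same_component_trans)
  have aj: "(a j, b j) \<in> ?R' v" "(a i, a j) \<in> ?R' v"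
    using same_component_trans[OF same_component_sym[OF aj'] ij_v] aj' by auto
  have "linked V ?F \<subset> linked V ?F'"
  proof (rule linked_psubset)
    show "?R u \<subseteq> ?R' u" if "u \<in> V" for u
      using that other mono[OF ai aj(1)] by (cases "u = v") auto
  qed (use aj j assms in auto)
  then show ?thesis using i j by blast
qed

text \<open>With \<open>v\<close> deleted, the pair \<open>(a i, v)\<close> is absent anyway, so
  redirecting it to \<open>w\<close> loses nothing there and joins two components. With another
  vertex deleted, the lost edge is replaced by a walk in \<open>E\<close> or by the detour through
  \<open>w\<close>.\<close>

lemma rewire_improves:
  assumes "connected_graph V E" "v \<in> V" "i < k" "b i = v" "a i \<in> V - {v}" "w \<in> V - {v}"
    and sep: "(a i, w) \<notin> same_component (V - {v}) (E \<union> pairing k a b)"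
  shows "linked V (E \<union> pairing k a b) \<subset> linked V (E \<union> pairing k a (b(i := w)))"
proof -
  let ?F = "E \<union> pairing k a b" and ?F' = "E \<union> pairing k a (b(i := w))"
  let ?R = "\<lambda>u. same_component (V - {u}) ?F" and ?R' = "\<lambda>u. same_component (V - {u}) ?F'"
  have E_R: "same_component (V - {u}) E \<subseteq> ?R u" for u by (rule same_component_mono) auto
  have E_R': "same_component (V - {u}) E \<subseteq> ?R' u" for u by (rule same_component_mono) auto
  have old: "(p, q) \<in> ?F' \<or> (p, q) = (a i, v)" if "(p, q) \<in> ?F" for p q
    using that assms(4) by (force simp: pairing_def)
  have new: "(a i, w) \<in> ?F'" using assms(3) by (force simp: pairing_def)
  have to_v: "(p, v) \<in> same_component (V - {u}) E" if "u \<in> V" "u \<noteq> v" "p \<in> V" "(p, u) \<notin> ?R v" for p u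
    using same_component_separator[OF assms(1) that(1) _ that(2,3)] that E_R[of v] assms by blast
  \<comment> \<open>\<open>a i\<close> and \<open>w\<close> lie in different components at \<open>v\<close>, so the deletion of \<open>u\<close> cuts at most one
    of them off from \<open>v\<close>.\<close>
  have keep: "(a i, v) \<in> ?R' u" if u: "u \<in> V" "u \<noteq> v" "a i \<noteq> u" for u
  proof (cases "(w, u) \<in> ?R v")
    case True
    then have "(a i, u) \<notin> ?R v" using sep same_component_sym same_component_trans by metis
    then have "(a i, v) \<in> same_component (V - {u}) E"
      using u assms by (intro to_v) auto
    then show ?thesis using E_R' by fast
  next
    case False
    then have "(w, v) \<in> same_component (V - {u}) E"
      using u assms by (intro to_v) auto
    then have "(w, v) \<in> ?R' u" by (rule subsetD[OF E_R'])
    moreover have "w \<noteq> u" using False assms by (auto intro: same_component_refl)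
    then have "(a i, w) \<in> ?R' u" using new u assms by (intro same_component_edge) auto
    ultimately show ?thesis by (blast intro: same_component_trans)
  qed
  show ?thesis
  proof (rule linked_psubset)
    show "?R u \<subseteq> ?R' u" if u: "u \<in> V" for u
    proof (rule same_component_subset)
      fix p q assume pq: "(p, q) \<in> ?F" "p \<in> V - {u}" "q \<in> V - {u}"
      from old[OF pq(1)] show "(p, q) \<in> ?R' u"
      proof
        assume "(p, q) \<in> ?F'"
        then show ?thesis using pq by (intro same_component_edge) auto
      qed (use keep u pq in auto)
    qed simp
    show "(a i, w) \<in> ?R' v" using new assms by (intro same_component_edge) auto
  qed (use assms in auto)
qed

lemma image_swap:
  assumes "i \<in> S" "j \<in> S"
  shows "(f(i := f j, j := f i)) ` S = f ` S"
proof -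
  have "f l \<in> (f(i := f j, j := f i)) ` S" if "l \<in> S" for l
  proof (cases "l = i \<or> l = j")
    case True
    have "f i = (f(i := f j, j := f i)) j" "f j = (f(i := f j, j := f i)) i" by auto
    then show ?thesis using True assms by (metis imageI)
  qed (use that in force)
  then show ?thesis using assms by auto
qed

text \<open>The potential is bounded by the number of triples, so its cardinality attains a maximum.
  The predicate \<open>Q\<close> is left open because two different families of rearrangements are
  used below.\<close>

lemma maximal_linked_exists:
  assumes "finite V" "Q b\<^sub>0"
  obtains b where "Q b" "\<And>c. Q c \<Longrightarrow> \<not> linked V (E \<union> pairing k a b) \<subset> linked V (E \<union> pairing k a c)"
proof -
  let ?f = "\<lambda>b. card (linked V (E \<union> pairing k a b))"
  have fin: "finite (linked V F)" for F
    by (rule finite_subset[OF linked_subset]) (use assms in auto)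
  have "\<forall>c. Q c \<longrightarrow> ?f c \<le> card (V \<times> V \<times> V)"
    using assms(1) linked_subset by (intro allI impI card_mono) auto
  with assms(2) obtain b where "Q b" "\<forall>c. Q c \<longrightarrow> ?f c \<le> ?f b"
    using ex_has_greatest_nat[of Q b\<^sub>0 ?f] by (metis le_imp_less_Suc)
  then show ?thesis using that psubset_card_mono[OF fin] by (meson leD)
qed

section \<open>Pairings that survive every vertex deletion\<close>

definition robustly_connected :: "'a set \<Rightarrow> ('a \<times> 'a) set \<Rightarrow> bool" where
  "robustly_connected V E \<longleftrightarrow>
     (\<forall>u\<in>V. \<forall>x\<in>V - {u}. \<forall>y\<in>V - {u}. (x, y) \<in> same_component (V - {u}) E)"

text \<open>Adding edges never separates vertices, so a failure can occur only at a cut vertex of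
  the original graph.\<close>

lemma not_robustly_connectedE:
  assumes "finite V" "connected_graph V E" "\<not> robustly_connected V (E \<union> F)"
  obtains v x y where "cut_vertex V E v" "v \<in> V" "x \<in> V - {v}" "y \<in> V - {v}"
    "(x, y) \<notin> same_component (V - {v}) (E \<union> F)"
proof -
  obtain v x y where v: "v \<in> V" "x \<in> V - {v}" "y \<in> V - {v}"
      "(x, y) \<notin> same_component (V - {v}) (E \<union> F)"
    using assms(3) unfolding robustly_connected_def by blast
  moreover have "same_component (V - {v}) E \<subseteq> same_component (V - {v}) (E \<union> F)"
    by (rule same_component_mono) auto
  ultimately have "cut_vertex V E v" using cut_vertex_iff[OF assms(1,2)] by blast
  then show ?thesis using v that by blast
qed

text \<open>Partners are rearranged with their set of values fixed, which preserves both the hitting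
  condition and the absence of cut vertices. Hence no endpoint ever equals the critical vertex
  \<open>v\<close>, as the exchange requires.\<close>

lemma robust_pairing_noncut:
  assumes "finite V" "connected_graph V E"
    and few: "\<And>v. cut_vertex V E v \<Longrightarrow> card (components (V - {v}) E) \<le> k + 1"
    and a: "\<And>i. i < k \<Longrightarrow> a i \<in> V \<and> \<not> cut_vertex V E (a i)"
    and b: "\<And>i. i < k \<Longrightarrow> b i \<in> V \<and> \<not> cut_vertex V E (b i)"
    and hit: "\<And>v C. cut_vertex V E v \<Longrightarrow> C \<in> components (V - {v}) E \<Longrightarrow>
           C \<inter> (a ` {..<k} \<union> b ` {..<k}) \<noteq> {}"
  shows "\<exists>c. c ` {..<k} = b ` {..<k} \<and> robustly_connected V (E \<union> pairing k a c)"
proof -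
  obtain c where c: "c ` {..<k} = b ` {..<k}"
    and max: "\<And>d. d ` {..<k} = b ` {..<k} \<Longrightarrow>
       \<not> linked V (E \<union> pairing k a c) \<subset> linked V (E \<union> pairing k a d)"
    using maximal_linked_exists[OF assms(1), of "\<lambda>c. c ` {..<k} = b ` {..<k}" b] by blast
  have "robustly_connected V (E \<union> pairing k a c)"
  proof (rule ccontr)
    assume "\<not> ?thesis"
    then obtain v x y where v: "cut_vertex V E v" "v \<in> V" "x \<in> V - {v}" "y \<in> V - {v}"
        "(x, y) \<notin> same_component (V - {v}) (E \<union> pairing k a c)"
      using not_robustly_connectedE[OF assms(1,2)] by blast
    have c': "c i \<in> V \<and> \<not> cut_vertex V E (c i)" if "i < k" for i
    proof -
      have "c i \<in> b ` {..<k}" using that c by blast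
      then show ?thesis using b by auto
    qed
    have "\<exists>i<k. \<exists>j<k. linked V (E \<union> pairing k a c)
           \<subset> linked V (E \<union> pairing k a (c(i := c j, j := c i)))"
      using assms(1,2) v(2) few[OF v(1)] _ _ v(3-5)
    proof (rule swap_improves)
      show "a i \<in> V - {v} \<and> c i \<in> V - {v}" if "i < k" for i
        using a[OF that] c'[OF that] v(1) by auto
      show "C \<inter> (a ` {..<k} \<union> c ` {..<k}) \<noteq> {}" if "C \<in> components (V - {v}) E" for C
        using hit[OF v(1) that] c by simp
    qed
    then obtain i j where ij: "i < k" "j < k" and
        better: "linked V (E \<union> pairing k a c) \<subset> linked V (E \<union> pairing k a (c(i := c j, j := c i)))"
      by blast
    have "(c(i := c j, j := c i)) ` {..<k} = c ` {..<k}"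
      using ij by (intro image_swap) auto
    then show False using max better c by metis
  qed
  with c show ?thesis by blast
qed

text \<open>Here the vertices \<open>a i\<close> alone hit all components, so the partners may vary
  freely in \<open>B\<close>. A partner may now be the critical vertex \<open>v\<close> itself, in
  which case the pair is redirected instead of exchanged.\<close>

lemma robust_pairing_free:
  assumes "finite V" "connected_graph V E"
    and few: "\<And>v. cut_vertex V E v \<Longrightarrow> card (components (V - {v}) E) \<le> k + 1"
    and a: "\<And>i. i < k \<Longrightarrow> a i \<in> V \<and> \<not> cut_vertex V E (a i)"
    and hit: "\<And>v C. cut_vertex V E v \<Longrightarrow> C \<in> components (V - {v}) E \<Longrightarrow> C \<inter> a ` {..<k} \<noteq> {}"
    and B: "B \<subseteq> V" "2 \<le> card B"
  shows "\<exists>b. b ` {..<k} \<subseteq> B \<and> robustly_connected V (E \<union> pairing k a b)"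
proof -
  have two: "\<exists>w\<in>B. w \<noteq> v" for v
  proof (rule ccontr)
    assume "\<not> ?thesis"
    then have "B \<subseteq> {v}" by blast
    then have "card B \<le> 1" using card_mono[of "{v}" B] by simp
    then show False using B(2) by simp
  qed
  then obtain b\<^sub>0 where "b\<^sub>0 \<in> B" by blast
  then have "(\<lambda>_::nat. b\<^sub>0) ` {..<k} \<subseteq> B" by auto
  then obtain b where b: "b ` {..<k} \<subseteq> B"
    and max: "\<And>d. d ` {..<k} \<subseteq> B \<Longrightarrow>
       \<not> linked V (E \<union> pairing k a b) \<subset> linked V (E \<union> pairing k a d)"
    using maximal_linked_exists[OF assms(1), of "\<lambda>b. b ` {..<k} \<subseteq> B"] by metis
  have "robustly_connected V (E \<union> pairing k a b)"
  proof (rule ccontr)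
    assume "\<not> ?thesis"
    then obtain v x y where v: "cut_vertex V E v" "v \<in> V" "x \<in> V - {v}" "y \<in> V - {v}"
        "(x, y) \<notin> same_component (V - {v}) (E \<union> pairing k a b)"
      using not_robustly_connectedE[OF assms(1,2)] by blast
    let ?R = "same_component (V - {v}) (E \<union> pairing k a b)"
    have av: "a i \<in> V - {v}" if "i < k" for i using a[OF that] v by auto
    \<comment> \<open>By maximality, a vertex paired with \<open>v\<close> is already joined to all
      of \<open>B - {v}\<close>.\<close>
    have no_rewire: "(a i, w) \<in> ?R" if "i < k" "b i = v" "w \<in> B - {v}" for i w
    proof (rule ccontr)
      assume "(a i, w) \<notin> ?R"
      then have "linked V (E \<union> pairing k a b) \<subset> linked V (E \<union> pairing k a (b(i := w)))"
        using assms(2) v that av B by (intro rewire_improves) auto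
      moreover have "(b(i := w)) ` {..<k} \<subseteq> B" using b that by auto
      ultimately show False using max by blast
    qed
    show False
    proof (cases "\<exists>i<k. b i = v")
      case False
      have "\<exists>i<k. \<exists>j<k. linked V (E \<union> pairing k a b)
             \<subset> linked V (E \<union> pairing k a (b(i := b j, j := b i)))"
        using assms(1,2) v(2) few[OF v(1)] _ _ v(3-5)
      proof (rule swap_improves)
        show "a i \<in> V - {v} \<and> b i \<in> V - {v}" if "i < k" for i
          using av[OF that] False that b B by auto
        show "C \<inter> (a ` {..<k} \<union> b ` {..<k}) \<noteq> {}" if "C \<in> components (V - {v}) E" for C
          using hit[OF v(1) that] by blast
      qed
      moreover have "(b(i := b j, j := b i)) ` {..<k} \<subseteq> B" if "i < k" "j < k" for i j
        using b that by auto
      ultimately show False using max by metis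
    next
      case True
      then obtain i where i: "i < k" "b i = v" by blast
      obtain w where w: "w \<in> B - {v}" using two by blast
      \<comment> \<open>The component of \<open>z\<close> contains some \<open>a j\<close>, which
        cannot be paired with \<open>v\<close>, since it would then be joined to \<open>w\<close>.
        So \<open>b j\<close> lies in \<open>B - {v}\<close> and in the component of
        \<open>z\<close>; but \<open>a i\<close> is joined to both \<open>b j\<close> and
        \<open>w\<close>, a contradiction.\<close>
      obtain z where z: "z \<in> V - {v}" "(z, w) \<notin> ?R"
        using v(3-5) same_component_sym same_component_trans by metis
      obtain j where j: "j < k" "(z, a j) \<in> same_component (V - {v}) E"
        using hit[OF v(1) component_of_mem[OF z(1)]] by auto
      have "same_component (V - {v}) E \<subseteq> ?R" by (rule same_component_mono) auto
      then have zj: "(z, a j) \<in> ?R" using j by blast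
      have bj: "b j \<noteq> v" using no_rewire[OF j(1) _ w] zj z same_component_trans by metis
      then have bjB: "b j \<in> B - {v}" using b j by auto
      then have "(a j, b j) \<in> ?R"
        using av[OF j(1)] B j(1) by (intro same_component_edge) (auto simp: pairing_def)
      then show False
        using no_rewire[OF i bjB] no_rewire[OF i w] zj z same_component_sym same_component_trans by metis
    qed
  qed
  with b show ?thesis by blast
qed

section \<open>Minimal fragments and pendant blocks\<close>

text \<open>In a connected graph these are the leaves of the block-cut tree with their cut vertex
  removed. Minimality is taken over the components at all cut vertices, not only at the one
  producing \<open>K\<close>.\<close>

definition ends :: "'a set \<Rightarrow> ('a \<times> 'a) set \<Rightarrow> 'a set set" where
  "ends V E = {K. (\<exists>v. cut_vertex V E v \<and> K \<in> components (V - {v}) E) \<and>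
     (\<forall>v C. cut_vertex V E v \<longrightarrow> C \<in> components (V - {v}) E \<longrightarrow> \<not> C \<subset> K)}"

lemma endE:
  assumes "K \<in> ends V E"
  obtains v where "cut_vertex V E v" "v \<in> V" "K \<in> components (V - {v}) E"
  using assms by (auto simp: ends_def cut_vertex_def)

lemma end_subset: "K \<in> ends V E \<Longrightarrow> K \<subseteq> V"
  by (auto elim!: endE dest: component_subset)

lemma end_nonempty: "K \<in> ends V E \<Longrightarrow> K \<noteq> {}"
  by (meson endE component_nonempty)

lemma end_below:
  assumes "finite V" "cut_vertex V E v" "C \<in> components (V - {v}) E"
  shows "\<exists>K\<in>ends V E. K \<subseteq> C"
proof -
  have "finite C" using assms component_subset by (metis finite_Diff finite_subset)
  then show ?thesis using assms(2,3)
  proof (induction C arbitrary: v rule: finite_psubset_induct)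
    case (psubset C)
    show ?case
    proof (cases "C \<in> ends V E")
      case False
      then obtain w D where D: "cut_vertex V E w" "D \<in> components (V - {w}) E" "D \<subset> C"
        using psubset.prems unfolding ends_def by blast
      have "\<exists>K\<in>ends V E. K \<subseteq> D" using D(3,1,2) by (rule psubset.IH)
      then show ?thesis using D(3) by blast
    qed blast
  qed
qed

text \<open>Without an edge to \<open>v\<close>, no walk could leave \<open>C\<close>, although
  \<open>v\<close> is reachable from it.\<close>

lemma component_adjacent:
  assumes "connected_graph V E" "v \<in> V" "C \<in> components (V - {v}) E"
  shows "\<exists>r\<in>C. (r, v) \<in> E \<or> (v, r) \<in> E"
proof (rule ccontr)
  assume none: "\<not> ?thesis"
  have CV: "C \<subseteq> V - {v}" using assms(3) by (rule component_subset)
  obtain x where x: "x \<in> C" using component_nonempty[OF assms(3)] by blast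
  have "w \<in> C" if "(x, w) \<in> same_component V E" for w
    using that
  proof (induction rule: same_component_induct)
    case (step y z)
    then have "z \<noteq> v" using none by blast
    then have "(y, z) \<in> same_component (V - {v}) E"
      using step CV by (intro same_component_edge) auto
    then show ?case using component_iff[OF assms(3)] step by blast
  qed (rule x)
  moreover have "(x, v) \<in> same_component V E" using assms x CV by (auto simp: connected_graph_def)
  ultimately show False using CV by blast
qed

text \<open>If \<open>u\<close> in \<open>K\<close> were a cut vertex, some component of
  \<open>G - u\<close> would miss \<open>v\<close>. Its vertices reach \<open>u\<close> without
  \<open>v\<close>, so it lies in \<open>K\<close>, and properly since it misses \<open>u\<close>;
  this contradicts minimality.\<close>

lemma end_not_cut_vertex:
  assumes "finite V" "connected_graph V E" "K \<in> ends V E" "u \<in> K"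
  shows "\<not> cut_vertex V E u"
proof
  assume cut: "cut_vertex V E u"
  obtain v where v: "cut_vertex V E v" "v \<in> V" "K \<in> components (V - {v}) E"
    using assms(3) by (rule endE)
  have u: "u \<in> V" "u \<noteq> v" using assms(4) component_subset[OF v(3)] by auto
  obtain p q where pq: "p \<in> V - {u}" "q \<in> V - {u}" "(p, q) \<notin> same_component (V - {u}) E"
    using cut unfolding cut_vertex_iff[OF assms(1,2) u(1)] by blast
  then obtain x where x: "x \<in> V - {u}" "(x, v) \<notin> same_component (V - {u}) E"
    using same_component_join[of p v "V - {u}" E q] by blast
  let ?C = "same_component (V - {u}) E `` {x}"
  have "y \<in> K" if "y \<in> ?C" for y
  proof -
    have "(y, v) \<notin> same_component (V - {u}) E" "y \<in> V"
      using that x same_component_trans same_component_mem by fast+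
    then have "(y, u) \<in> same_component (V - {v}) E"
      using same_component_separator[OF assms(2) v(2) u(1)] u by auto
    then show ?thesis using component_iff[OF v(3) assms(4)] same_component_sym by fast
  qed
  moreover have "u \<notin> ?C" by (auto dest: same_component_mem)
  ultimately have "?C \<subset> K" using assms(4) by blast
  moreover have "?C \<in> components (V - {u}) E" using x(1) by (rule component_of_mem)
  ultimately show False using assms(3) cut unfolding ends_def by blast
qed

section \<open>The pendant block belonging to an end\<close>

lemma same_component_isolated:
  assumes "(x, y) \<in> same_component V E" "\<And>w. w \<in> V \<Longrightarrow> (x, w) \<notin> E \<and> (w, x) \<notin> E"
  shows "y = x"
  using assms(1)
proof (induction rule: same_component_induct)
  case (step y z)
  then show ?case using assms(2) by blast
qed simp

text \<open>The only neighbour of \<open>x\<close> is \<open>v\<close>. Deleting the edge between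
  them separates \<open>x\<close> from \<open>v\<close>, and deleting \<open>v\<close> separates
  \<open>x\<close> from every other vertex, so \<open>x\<close> forms a singular block of degree
  one.\<close>

lemma pendant_leaf:
  assumes bip: "bipartite_graph A B E" and conn: "connected_graph (A \<union> B) E"
    and v: "v \<in> A \<union> B" "{x} \<in> components (A \<union> B - {v}) E"
  shows "{x} \<in> pendant_blocks (A \<union> B) E"
proof -
  let ?V = "A \<union> B"
  have asym: "(q, p) \<notin> E" if "(p, q) \<in> E" for p q
    using that bip by (auto simp: bipartite_graph_def)
  have x: "x \<in> ?V" "x \<noteq> v" using component_subset[OF v(2)] by auto
  have nb: "w = v" if w: "w \<in> ?V" "(x, w) \<in> E \<or> (w, x) \<in> E" for w
  proof (rule ccontr)
    assume "w \<noteq> v"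
    then have "(x, w) \<in> same_component (?V - {v}) E" using w x by (intro same_component_edge) auto
    then have "w = x" using component_iff[OF v(2), of x w] by auto
    then show False using w asym by blast
  qed
  have adj: "(x, v) \<in> E \<or> (v, x) \<in> E" using component_adjacent[OF conn v] by auto
  have "{w \<in> ?V. (x, w) \<in> E \<union> E\<inverse>} = {v}" using nb adj v(1) by blast
  then have deg: "degree ?V E x = 1" unfolding degree_def by simp
  have nbic: "\<not> biconnected ?V E x y" if "y \<noteq> x" for y
  proof
    assume bc: "biconnected ?V E x y"
    show False
    proof (cases "y = v")
      case True
      \<comment> \<open>The edge is stored in one unknown orientation, and by \<open>asym\<close>
        only in that one.\<close>
      define e where "e = (if (x, v) \<in> E then (x, v) else (v, x))"
      have "e \<in> E" using adj by (auto simp: e_def)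
      then have "(x, y) \<in> same_component ?V (E - {e})" using bc by (auto simp: biconnected_def)
      moreover have "(x, w) \<notin> E - {e} \<and> (w, x) \<notin> E - {e}" if "w \<in> ?V" for w
        using nb[OF that] asym by (auto simp: e_def)
      ultimately have "y = x" by (rule same_component_isolated)
      then show False using that by simp
    next
      case False
      then have "(x, y) \<in> same_component (?V - {v}) E" using bc v x by (auto simp: biconnected_def)
      then show False using component_iff[OF v(2), of x y] that by auto
    qed
  qed
  have "T = {x}" if T: "biconnected_set ?V E T" "{x} \<subseteq> T" for T
  proof -
    have "y = x" if "y \<in> T" for y
    proof (rule ccontr)
      assume "y \<noteq> x"
      moreover have "x \<in> T" using T(2) by simp
      ultimately have "biconnected ?V E x y" using T(1) that by (simp add: biconnected_set_def)
      then show False using nbic \<open>y \<noteq> x\<close> by simp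
    qed
    then show ?thesis using T(2) by blast
  qed
  moreover have "biconnected_set ?V E {x}" using x by (simp add: biconnected_set_def)
  ultimately have "block ?V E {x}" unfolding block_def by blast
  then show ?thesis using deg unfolding pendant_blocks_def by blast
qed

text \<open>Within \<open>insert v K\<close>, deleting a vertex of \<open>K\<close> is harmless
  since it is no cut vertex, deleting \<open>v\<close> leaves \<open>K\<close> connected, and a
  vertex outside cannot come between \<open>K\<close> and \<open>v\<close>. The set is maximal
  because \<open>v\<close> separates \<open>K\<close> from everything outside.\<close>

lemma pendant_nonsingular:
  assumes bip: "bipartite_graph A B E" and conn: "connected_graph (A \<union> B) E"
    and v: "cut_vertex (A \<union> B) E v" "v \<in> A \<union> B" "K \<in> components (A \<union> B - {v}) E"
    and nocut: "\<And>u. u \<in> K \<Longrightarrow> \<not> cut_vertex (A \<union> B) E u" and big: "\<And>x. K \<noteq> {x}"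
  shows "insert v K \<in> pendant_blocks (A \<union> B) E"
proof -
  let ?V = "A \<union> B" and ?S = "insert v K"
  have fin: "finite ?V" using bip by (simp add: bipartite_graph_def)
  have KV: "K \<subseteq> ?V - {v}" using v(3) by (rule component_subset)
  have KI: "y \<in> K \<longleftrightarrow> (x, y) \<in> same_component (?V - {v}) E" if "x \<in> K" for x y
    using that by (rule component_iff[OF v(3)])
  have minus: "(x, y) \<in> same_component (?V - {u}) E"
    if "u \<in> K" "x \<in> ?V - {u}" "y \<in> ?V - {u}" for u x y
    using that nocut[OF that(1)] cut_vertex_iff[OF fin conn, of u] KV by blast
  have to_v: "(x, v) \<in> same_component (?V - {z}) E" if "x \<in> ?S" "z \<in> ?V - ?S" for x z
  proof (cases "x = v")
    case True
    then show ?thesis using that v by (auto intro: same_component_refl)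
  next
    case False
    then have "(x, z) \<notin> same_component (?V - {v}) E" using that KI by blast
    then show ?thesis using same_component_separator[OF conn _ v(2)] that KV False by blast
  qed
  have vertex: "(x, y) \<in> same_component (?V - {z}) E"
    if "x \<in> ?S" "y \<in> ?S" and z: "z \<in> ?V" "z \<noteq> x" "z \<noteq> y" for x y z
  proof -
    consider "z \<in> K" | "z = v" | "z \<in> ?V - ?S" using z by blast
    then show ?thesis
    proof cases
      case 1
      then show ?thesis using minus that KV v(2) by blast
    next
      case 2
      then show ?thesis using that KI by blast
    next
      case 3
      then show ?thesis using to_v that same_component_join by metis
    qed
  qed
  have edge: "(x, y) \<in> same_component ?V (E - {(p, q)})"
    if xy: "x \<in> ?S" "y \<in> ?S" and e: "(p, q) \<in> E" for x y p q
  proof -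
    let ?T = "same_component ?V (E - {(p, q)})"
    have "p \<noteq> q" "p \<in> ?V" "q \<in> ?V" using e bip by (auto simp: bipartite_graph_def)
    have avoid: "same_component (?V - {p}) E \<subseteq> ?T" "same_component (?V - {q}) E \<subseteq> ?T"
      by (rule same_component_subset; auto intro!: same_component_edge)+
    \<comment> \<open>If the ends of the deleted edge remain joined, all connections
      survive.\<close>
    have all: "(x, y) \<in> ?T" if "(p, q) \<in> ?T"
    proof -
      have "same_component ?V E \<subseteq> ?T"
      proof (rule same_component_subset)
        show "(s, t) \<in> ?T" if "(s, t) \<in> E" "s \<in> ?V" "t \<in> ?V" for s t
          using that \<open>(p, q) \<in> ?T\<close> by (cases "(s, t) = (p, q)") (auto intro: same_component_edge)
      qed simp
      moreover have "(x, y) \<in> same_component ?V E"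
        using xy conn KV v(2) by (auto simp: connected_graph_def)
      ultimately show ?thesis by blast
    qed
    have in_S: "t \<in> ?S" if "s \<in> K" "t \<in> ?V" "(s, t) \<in> E \<or> (t, s) \<in> E" for s t
    proof (rule ccontr)
      assume t: "t \<notin> ?S"
      then have "(s, t) \<in> same_component (?V - {v}) E"
        using that KV by (intro same_component_edge) auto
      then show False using KI that t by blast
    qed
    have leg: "\<exists>r\<in>K. r \<noteq> s" for s
    proof (rule ccontr)
      assume "\<not> ?thesis"
      then have "K = {s}" using component_nonempty[OF v(3)] by auto
      then show False using big by simp
    qed
    \<comment> \<open>Every edge meeting \<open>K\<close> lies on a cycle, obtained by going around through a third vertex
      \<open>r\<close> of the block.\<close>
    have around: "(p, q) \<in> ?T" if "r \<in> ?V" "r \<noteq> p" "r \<noteq> q"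
      "(p, r) \<in> same_component (?V - {q}) E" "(r, q) \<in> same_component (?V - {p}) E" for r
      using that avoid same_component_trans[of p r ?V _ q] by blast
    consider "p \<in> K" "q \<in> K" | "p \<in> K" "q = v" | "p = v" "q \<in> K" | "p \<notin> K" "q \<notin> K"
      using in_S[of p q] in_S[of q p] e \<open>p \<in> ?V\<close> \<open>q \<in> ?V\<close> by blast
    then show ?thesis
    proof cases
      case 1
      have "v \<noteq> p" "v \<noteq> q" using 1 KV by auto
      then have "(p, q) \<in> ?T"
        using minus[OF 1(2), of p v] minus[OF 1(1), of v q]
          v(2) \<open>p \<in> ?V\<close> \<open>q \<in> ?V\<close> \<open>p \<noteq> q\<close> by (intro around[of v]) auto
      then show ?thesis by (rule all)
    next
      case 2
      obtain r where r: "r \<in> K" "r \<noteq> p" using leg by blast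
      have "(p, q) \<in> ?T"
        using KI[OF 2(1), of r] minus[OF 2(1), of r q] r 2 KV v(2) by (intro around[of r]) auto
      then show ?thesis by (rule all)
    next
      case 3
      obtain r where r: "r \<in> K" "r \<noteq> q" using leg by blast
      have "(p, q) \<in> ?T"
        using KI[OF r(1), of q] minus[OF 3(2), of p r] r 3 KV v(2) by (intro around[of r]) auto
      then show ?thesis by (rule all)
    next
      \<comment> \<open>One end of the edge lies outside the block; even deleting that whole vertex
        leaves \<open>x\<close> and \<open>y\<close> joined to \<open>v\<close>.\<close>
      case 4
      have "p \<in> ?V - ?S \<or> q \<in> ?V - ?S" using 4 \<open>p \<noteq> q\<close> \<open>p \<in> ?V\<close> \<open>q \<in> ?V\<close> by blast
      then have "(x, v) \<in> ?T \<and> (y, v) \<in> ?T" using to_v xy avoid by blast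
      then show ?thesis using same_component_join by metis
    qed
  qed
  have SV: "?S \<subseteq> ?V" using KV v(2) by blast
  have "biconnected ?V E x y" if xy: "x \<in> ?S" "y \<in> ?S" for x y
    unfolding biconnected_def
  proof (intro conjI ballI)
    show "(x, y) \<in> same_component ?V E" using xy SV conn unfolding connected_graph_def by blast
    show "(x, y) \<in> same_component ?V (E - {e})" if "e \<in> E" for e
      using edge xy that by (cases e) simp
    show "(x, y) \<in> same_component (?V - {z}) E" if "z \<in> ?V - {x, y}" for z
      using vertex xy that by simp
  qed
  then have bic: "biconnected_set ?V E ?S" using SV by (simp add: biconnected_set_def)
  have max: "T = ?S" if T: "biconnected_set ?V E T" "?S \<subseteq> T" for T
  proof (rule ccontr)
    assume "T \<noteq> ?S"
    then obtain w where w: "w \<in> T" "w \<notin> ?S" using T(2) by blast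
    obtain x where x: "x \<in> K" using component_nonempty[OF v(3)] by blast
    have "x \<in> T" "x \<noteq> w" using T(2) w x by auto
    then have "biconnected ?V E x w" using T(1) w(1) by (simp add: biconnected_set_def)
    then have "(x, w) \<in> same_component (?V - {v}) E"
      using w x KV v(2) unfolding biconnected_def by blast
    then show False using KI[OF x] w by blast
  qed
  have "block ?V E ?S"
    unfolding block_def by (intro conjI allI impI bic max) auto
  moreover have "{c \<in> ?S. cut_vertex ?V E c} = {v}" using v(1) nocut by blast
  then have "card {c \<in> ?S. cut_vertex ?V E c} = 1" by simp
  moreover have "card ?S \<noteq> 1"
    using KV component_nonempty[OF v(3)] by (auto simp: card_1_singleton_iff)
  ultimately show ?thesis
    unfolding pendant_blocks_def by (intro CollectI conjI disjI2)
qed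

text \<open>The end is recovered from the block as its set of non-cut vertices. This makes the
  assignment injective and determines the type of the block.\<close>

lemma pendant_block_of_end:
  assumes "bipartite_graph A B E" "connected_graph (A \<union> B) E" "K \<in> ends (A \<union> B) E"
  shows "\<exists>S\<in>pendant_blocks (A \<union> B) E. {x \<in> S. \<not> cut_vertex (A \<union> B) E x} = K"
proof -
  have fin: "finite (A \<union> B)" using assms(1) by (simp add: bipartite_graph_def)
  obtain v where v: "cut_vertex (A \<union> B) E v" "v \<in> A \<union> B" "K \<in> components (A \<union> B - {v}) E"
    using assms(3) by (rule endE)
  have nocut: "\<not> cut_vertex (A \<union> B) E u" if "u \<in> K" for u
    using end_not_cut_vertex[OF fin assms(2,3) that] .
  show ?thesis
  proof (cases "\<exists>x. K = {x}")
    case True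
    then obtain x where x: "K = {x}" by blast
    show ?thesis
      using pendant_leaf[OF assms(1,2) v(2) v(3)[unfolded x]] nocut x by blast
  next
    case False
    then have "insert v K \<in> pendant_blocks (A \<union> B) E"
      using pendant_nonsingular[OF assms(1,2) v nocut] by blast
    moreover have "{x \<in> insert v K. \<not> cut_vertex (A \<union> B) E x} = K" using v(1) nocut by blast
    ultimately show ?thesis by blast
  qed
qed

section \<open>Lower bounds for \<open>\<eta>\<close>\<close>

lemma finite_pendant_blocks: "finite V \<Longrightarrow> finite (pendant_blocks V E)"
  by (rule finite_subset[of _ "Pow V"])
    (auto simp: pendant_blocks_def block_def biconnected_set_def)

text \<open>Keeps just enough of the four type combinations to exclude that both members have all
  their non-cut vertices on the same side.\<close>

lemma legal_pairE:
  assumes "p \<in> legal_pairs A B E"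
  obtains P Q where "p = {P, Q}" "P \<noteq> Q"
    "type_B A B E Q \<or> type_AB A B E Q" "type_A A B E P \<or> type_AB A B E P \<or> type_AB A B E Q"
  using assms unfolding legal_pairs_def by blast

lemma max_matching_attained:
  assumes "finite \<Lambda>"
  obtains M where "legal_matching A B E \<Lambda> M" "card M = max_matching A B E \<Lambda>"
proof -
  have "{M. legal_matching A B E \<Lambda> M} \<subseteq> Pow (Pow \<Lambda>)" by (auto simp: legal_matching_def)
  then have "finite {M. legal_matching A B E \<Lambda> M}" using assms by (meson finite_Pow_iff finite_subset)
  moreover have "legal_matching A B E \<Lambda> {}" by (simp add: legal_matching_def)
  ultimately have "max_matching A B E \<Lambda> \<in> card ` {M. legal_matching A B E \<Lambda> M}"
    unfolding max_matching_def by (intro Max_in) auto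
  then show ?thesis using that by auto
qed

lemma matching_card_double:
  assumes "finite \<Lambda>" "legal_matching A B E \<Lambda> M"
  shows "2 * card M \<le> card \<Lambda>"
proof -
  have sub: "\<And>p. p \<in> M \<Longrightarrow> p \<subseteq> \<Lambda>" using assms(2) by (auto simp: legal_matching_def)
  have two: "card p = 2" if "p \<in> M" for p
  proof -
    have "p \<in> legal_pairs A B E" using that assms(2) by (auto simp: legal_matching_def)
    then obtain P Q where "p = {P, Q}" "P \<noteq> Q" by (rule legal_pairE)
    then show ?thesis by simp
  qed
  have disj: "p \<inter> q = {}" if "p \<in> M" "q \<in> M" "p \<noteq> q" for p q
  proof (rule ccontr)
    assume "p \<inter> q \<noteq> {}"
    then obtain P where P: "P \<in> p" "P \<in> q" by blast
    then have "P \<in> \<Lambda>" using sub that(1) by blast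
    then show False using P that assms(2) by (simp add: legal_matching_def)
  qed
  have "card (\<Union>M) = (\<Sum>p\<in>M. card p)"
    using disj finite_subset[OF sub assms(1)] by (intro card_Union_disjoint) (auto simp: pairwise_def disjnt_def)
  also have "\<dots> = 2 * card M" using two by simp
  finally show ?thesis using sub assms(1) by (metis Union_least card_mono)
qed

text \<open>Every matched pair has a member outside \<open>I\<close>, and these members are distinct
  for distinct pairs.\<close>

lemma matching_card_independent:
  assumes "finite \<Lambda>" "legal_matching A B E \<Lambda> M" "I \<subseteq> \<Lambda>"
    and ind: "\<And>p. p \<in> legal_pairs A B E \<Longrightarrow> \<not> p \<subseteq> I"
  shows "card M + card I \<le> card \<Lambda>"
proof -
  have M: "p \<in> legal_pairs A B E" "p \<subseteq> \<Lambda>" if "p \<in> M" for p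
    using that assms(2) by (auto simp: legal_matching_def)
  have "\<forall>p\<in>M. \<exists>P. P \<in> p - I" using ind[OF M(1)] by auto
  then obtain f where f: "\<And>p. p \<in> M \<Longrightarrow> f p \<in> p - I" by metis
  have img: "f ` M \<subseteq> \<Lambda> - I" using f M(2) by blast
  have "inj_on f M"
  proof (rule inj_onI)
    fix p q assume pq: "p \<in> M" "q \<in> M" "f p = f q"
    have "f p \<in> p" "f p \<in> q" using f[OF pq(1)] f[OF pq(2)] pq(3) by auto
    moreover have "f p \<in> \<Lambda>" using img pq(1) by blast
    ultimately show "p = q" using pq(1,2) assms(2) by (simp add: legal_matching_def)
  qed
  then have "card M \<le> card (\<Lambda> - I)" using img assms(1) by (intro card_inj_on_le) auto
  also have "\<dots> = card \<Lambda> - card I" using assms(1,3) by (simp add: card_Diff_subset finite_subset)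
  finally show ?thesis using card_mono[OF assms(1,3)] by simp
qed

text \<open>Matched plus unmatched is \<open>M + (n - 2 * M) = n - M\<close> for \<open>n\<close>
  pendant blocks and maximum matching size \<open>M\<close>.\<close>

lemma eta_ge_matching:
  "int (card (pendant_blocks (A \<union> B) E)) - int (max_matching A B E (pendant_blocks (A \<union> B) E))
     \<le> eta A B E"
  by (simp add: eta_def unmatched_def)

text \<open>A connected graph with a cut vertex has exactly one non-block component, so the first
  term of \<open>eta\<close> at \<open>v\<close> is the component count plus
  \<open>1 - 2\<close>.\<close>

lemma eta_ge_split:
  assumes fin: "finite (A \<union> B)" and conn: "connected_graph (A \<union> B) E" and cut: "cut_vertex (A \<union> B) E v"
  shows "int (card (components (A \<union> B - {v}) E)) - 1 \<le> eta A B E"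
proof -
  let ?V = "A \<union> B"
  have v: "v \<in> ?V" using cut by (simp add: cut_vertex_def)
  have comp: "same_component ?V E `` {v} = ?V"
    using component_of_mem[OF v] components_connected[OF conn] by blast
  obtain x y where "x \<in> ?V - {v}" "y \<in> ?V - {v}" "(x, y) \<notin> same_component (?V - {v}) E"
    using cut cut_vertex_iff[OF fin conn v] by blast
  then have "\<not> biconnected ?V E x y" "x \<noteq> y" "x \<in> ?V" "y \<in> ?V"
    using v by (auto simp: biconnected_def intro: same_component_refl)
  then have "\<not> block ?V E ?V" unfolding block_def biconnected_set_def by blast
  then have "{X \<in> components ?V E. \<not> block ?V E X} = {?V}"
    using components_connected[OF conn] by auto
  then have nb: "nonblock_components ?V E = 1" by (simp add: nonblock_components_def)
  have "int (split_number ?V E v) + int (nonblock_components ?V E) - 2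
      \<le> Max ((\<lambda>u. int (split_number ?V E u) + int (nonblock_components ?V E) - 2) ` ?V)"
    using fin v by (intro Max_ge) auto
  also have "\<dots> \<le> eta A B E" by (simp add: eta_def)
  finally show ?thesis using nb comp by (simp add: split_number_def)
qed

text \<open>With \<open>n\<close> pendant blocks and a maximum matching \<open>M\<close>,
  \<open>eta\<close> is at least \<open>n - card M\<close>. Blocks whose ends lie in one side
  contain no legal pair, so their number is at most \<open>n - card M\<close>; and
  \<open>2 * card M \<le> n\<close> gives the bound on all ends.\<close>

lemma eta_ge_ends:
  assumes bip: "bipartite_graph A B E" and conn: "connected_graph (A \<union> B) E"
  shows "int (card {K \<in> ends (A \<union> B) E. K \<subseteq> A}) \<le> eta A B E"
    and "int (card {K \<in> ends (A \<union> B) E. K \<subseteq> B}) \<le> eta A B E"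
    and "int (card (ends (A \<union> B) E)) \<le> 2 * eta A B E"
    and "0 \<le> eta A B E"
proof -
  let ?V = "A \<union> B" and ?\<Lambda> = "pendant_blocks (A \<union> B) E"
  let ?nc = "\<lambda>S. {x \<in> S. \<not> cut_vertex (A \<union> B) E x}"
  have fin: "finite ?V" and AB: "A \<inter> B = {}" using bip by (auto simp: bipartite_graph_def)
  have fin\<Lambda>: "finite ?\<Lambda>" using fin by (rule finite_pendant_blocks)
  have "\<forall>K\<in>ends ?V E. \<exists>S. S \<in> ?\<Lambda> \<and> ?nc S = K"
    using pendant_block_of_end[OF bip conn] by blast
  then obtain f where f: "\<And>K. K \<in> ends ?V E \<Longrightarrow> f K \<in> ?\<Lambda>" "\<And>K. K \<in> ends ?V E \<Longrightarrow> ?nc (f K) = K"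
    by metis
  have inj: "inj_on f (ends ?V E)" using f(2) by (rule inj_on_inverseI[of _ ?nc])
  obtain M where M: "legal_matching A B E ?\<Lambda> M" "card M = max_matching A B E ?\<Lambda>"
    using max_matching_attained[OF fin\<Lambda>] .
  note double = matching_card_double[OF fin\<Lambda> M(1)]
  have eta: "int (card ?\<Lambda>) - int (card M) \<le> eta A B E" using eta_ge_matching M(2) by metis
  have "card (ends ?V E) \<le> card ?\<Lambda>" using inj f(1) fin\<Lambda> by (meson card_inj_on_le image_subsetI)
  then show "int (card (ends ?V E)) \<le> 2 * eta A B E" "0 \<le> eta A B E" using eta double by linarith+
  have side: "int (card \<K>) \<le> eta A B E"
    if \<K>: "\<K> \<subseteq> ends ?V E" and ind: "\<And>p. p \<in> legal_pairs A B E \<Longrightarrow> \<not> p \<subseteq> f ` \<K>" for \<K>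
  proof -
    have "card M + card (f ` \<K>) \<le> card ?\<Lambda>"
      using \<K> f(1) by (intro matching_card_independent[OF fin\<Lambda> M(1) _ ind]) auto
    moreover have "card (f ` \<K>) = card \<K>" using inj \<K> by (meson card_image inj_on_subset)
    ultimately show ?thesis using eta by linarith
  qed
  have noncut: "\<exists>x\<in>f K. \<not> cut_vertex ?V E x \<and> x \<in> K" if "K \<in> ends ?V E" for K
    using f(2)[OF that] end_nonempty[OF that] by blast
  have only: "x \<in> K" if "K \<in> ends ?V E" "x \<in> f K" "\<not> cut_vertex ?V E x" for K x
    using f(2)[OF that(1)] that by blast
  \<comment> \<open>The non-cut vertices of such a block form a nonempty subset of
    \<open>A\<close>.\<close>
  have tA: "\<not> type_B A B E S \<and> \<not> type_AB A B E S" if S: "S \<in> f ` {K \<in> ends ?V E. K \<subseteq> A}" for S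
  proof -
    obtain K where K: "K \<in> ends ?V E" "K \<subseteq> A" "S = f K" using S by blast
    show ?thesis
      unfolding type_B_def type_AB_def using noncut[OF K(1)] only[OF K(1)] K(2,3) AB by blast
  qed
  have tB: "\<not> type_A A B E S \<and> \<not> type_AB A B E S" if S: "S \<in> f ` {K \<in> ends ?V E. K \<subseteq> B}" for S
  proof -
    obtain K where K: "K \<in> ends ?V E" "K \<subseteq> B" "S = f K" using S by blast
    show ?thesis
      unfolding type_A_def type_AB_def using noncut[OF K(1)] only[OF K(1)] K(2,3) AB by blast
  qed
  show "int (card {K \<in> ends ?V E. K \<subseteq> A}) \<le> eta A B E"
    using tA by (intro side) (auto elim!: legal_pairE)
  show "int (card {K \<in> ends ?V E. K \<subseteq> B}) \<le> eta A B E"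
    using tB by (intro side) (auto elim!: legal_pairE)
qed

section \<open>Construction of a biconnector\<close>

text \<open>Enumerate \<open>S\<close> and fill the remaining indices with a fixed element of
  \<open>X\<close>, which also covers an empty \<open>S\<close>.\<close>

lemma enumerate_covering:
  assumes "finite S" "card S \<le> k" "S \<subseteq> X" "X \<noteq> {}"
  shows "\<exists>a :: nat \<Rightarrow> 'a. range a \<subseteq> X \<and> S \<subseteq> a ` {..<k}"
proof -
  obtain x where x: "x \<in> X" using assms(4) by blast
  obtain h where h: "bij_betw h {0..<card S} S" using ex_bij_betw_nat_finite[OF assms(1)] by blast
  let ?a = "\<lambda>i. if i < card S then h i else x"
  have "h i \<in> S" if "i < card S" for i using h that by (auto simp: bij_betw_def)
  then have "range ?a \<subseteq> X" using x assms(3) by auto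
  moreover have "S \<subseteq> ?a ` {..<k}"
  proof
    fix s assume "s \<in> S"
    then obtain i where "i < card S" "h i = s" using bij_betw_imp_surj_on[OF h] by (metis atLeastLessThan_iff imageE)
    then show "s \<in> ?a ` {..<k}" using assms(2) by (intro image_eqI[of _ _ i]) auto
  qed
  ultimately show ?thesis by blast
qed

text \<open>Edge deletions come for free with three vertices: the ends \<open>p\<close>,
  \<open>q\<close> of the edge are joined through a third vertex \<open>r\<close>, first avoiding
  \<open>q\<close>, then avoiding \<open>p\<close>.\<close>

lemma robustly_connected_componentwise_biconnected:
  assumes bip: "bipartite_graph A B F" and conn: "connected_graph (A \<union> B) F"
    and robust: "robustly_connected (A \<union> B) F" and "2 < card (A \<union> B)"
  shows "componentwise_biconnected (A \<union> B) F"
proof -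
  let ?V = "A \<union> B"
  have minus: "(x, y) \<in> same_component (?V - {u}) F"
    if "u \<in> ?V" "x \<in> ?V - {u}" "y \<in> ?V - {u}" for u x y
    using robust that unfolding robustly_connected_def by blast
  have "(x, y) \<in> same_component ?V (F - {e})" if xy: "x \<in> ?V" "y \<in> ?V" and e: "e \<in> F" for x y e
  proof -
    obtain p q where pq: "e = (p, q)" "p \<in> ?V" "q \<in> ?V" "p \<noteq> q"
      using e bip by (cases e) (auto simp: bipartite_graph_def)
    let ?T = "same_component ?V (F - {e})"
    have avoid: "same_component (?V - {p}) F \<subseteq> ?T" "same_component (?V - {q}) F \<subseteq> ?T"
      by (rule same_component_subset; auto simp: pq(1) intro!: same_component_edge)+
    have "\<not> ?V \<subseteq> {p, q}" using assms(4) pq(4) card_mono[of "{p, q}" ?V] by auto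
    then obtain r where r: "r \<in> ?V" "r \<noteq> p" "r \<noteq> q" by blast
    have "(p, r) \<in> ?T" "(r, q) \<in> ?T"
      using avoid minus[of q p r] minus[of p r q] r pq by blast+
    then have T: "(p, q) \<in> ?T" by (rule same_component_trans)
    have "same_component ?V F \<subseteq> ?T"
    proof (rule same_component_subset)
      show "(s, t) \<in> ?T" if "(s, t) \<in> F" "s \<in> ?V" "t \<in> ?V" for s t
        using that T pq(1) by (cases "(s, t) = (p, q)") (auto intro: same_component_edge)
    qed simp
    then show ?thesis using conn xy unfolding connected_graph_def by blast
  qed
  then have "biconnected ?V F x y" if "x \<in> ?V" "y \<in> ?V" for x y
    using that conn minus unfolding biconnected_def connected_graph_def by blast
  then have "block ?V F ?V" unfolding block_def biconnected_set_def by blast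
  then show ?thesis using components_connected[OF conn] by (simp add: componentwise_biconnected_def)
qed

text \<open>The new pairs may repeat existing edges, which are not legal; removing them leaves the
  union with \<open>E\<close> unchanged.\<close>

lemma biconnector_of_robust:
  assumes bip: "bipartite_graph A B E" and conn: "connected_graph (A \<union> B) E"
    and "2 < card (A \<union> B)" "L \<subseteq> A \<times> B" "robustly_connected (A \<union> B) (E \<union> L)"
  shows "biconnector A B E (L - E)"
proof -
  have "bipartite_graph A B (E \<union> L)" using bip assms(4) by (auto simp: bipartite_graph_def)
  moreover have "same_component (A \<union> B) E \<subseteq> same_component (A \<union> B) (E \<union> L)"
    by (rule same_component_mono) auto
  then have "connected_graph (A \<union> B) (E \<union> L)" using conn unfolding connected_graph_def by blast
  ultimately have "componentwise_biconnected (A \<union> B) (E \<union> L)"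
    using assms(3,5) by (intro robustly_connected_componentwise_biconnected)
  then show ?thesis using assms(4) by (auto simp: biconnector_def)
qed

section \<open>Endpoints that hit every end\<close>

lemma hits_component:
  assumes "finite V" "\<And>K. K \<in> ends V E \<Longrightarrow> K \<inter> S \<noteq> {}"
    and "cut_vertex V E v" "C \<in> components (V - {v}) E"
  shows "C \<inter> S \<noteq> {}"
  using end_below[OF assms(1,3,4)] assms(2) by blast

lemma robust_pairing_exists_noncut:
  fixes A B :: "'a set"
  assumes bip: "bipartite_graph A B E" and conn: "connected_graph (A \<union> B) E"
    and few: "\<And>v. cut_vertex (A \<union> B) E v \<Longrightarrow> card (components (A \<union> B - {v}) E) \<le> k + 1"
    and x: "x \<in> A" "\<not> cut_vertex (A \<union> B) E x" and y: "y \<in> B" "\<not> cut_vertex (A \<union> B) E y"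
    and kA: "card {K \<in> ends (A \<union> B) E. K \<subseteq> A} \<le> k"
    and kB: "card {K \<in> ends (A \<union> B) E. K \<subseteq> B} \<le> k"
    and kAB: "card (ends (A \<union> B) E) \<le> 2 * k"
  shows "\<exists>a b. a ` {..<k} \<subseteq> A \<and> b ` {..<k} \<subseteq> B \<and> robustly_connected (A \<union> B) (E \<union> pairing k a b)"
proof -
  let ?V = "A \<union> B"
  let ?EA = "{K \<in> ends ?V E. K \<subseteq> A}" and ?EB = "{K \<in> ends ?V E. K \<subseteq> B}"
  have fin: "finite ?V" and AB: "A \<inter> B = {}" using bip by (auto simp: bipartite_graph_def)
  have finE: "finite (ends ?V E)"
    by (rule finite_subset[of _ "Pow ?V"]) (use end_subset fin in auto)
  have sub: "?EA \<subseteq> ends ?V E - ?EB" using AB end_nonempty by fast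
  obtain P where P: "?EA \<subseteq> P" "P \<subseteq> ends ?V E - ?EB" "card P \<le> k" "card (ends ?V E - P) \<le> k"
  proof -
    have cB: "card (ends ?V E - ?EB) = card (ends ?V E) - card ?EB"
      using finE by (intro card_Diff_subset) auto
    have "card ?EA \<le> card (ends ?V E - ?EB)" using sub finE by (intro card_mono) auto
    \<comment> \<open>If the minimum is \<open>k\<close>, at most \<open>2 * k - k\<close> ends
      remain; otherwise exactly the ends inside \<open>B\<close> remain, again at most
      \<open>k\<close>.\<close>
    then obtain P where P: "?EA \<subseteq> P" "P \<subseteq> ends ?V E - ?EB" "card P = min k (card (ends ?V E - ?EB))"
      using exists_subset_between[of ?EA "min k (card (ends ?V E - ?EB))" "ends ?V E - ?EB"] kA sub finE
      by auto
    have "card (ends ?V E - P) = card (ends ?V E) - card P"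
      using P(2) finE by (intro card_Diff_subset) (auto intro: finite_subset)
    then have "card (ends ?V E - P) \<le> k" using P(3) cB kB kAB by (auto simp: min_def split: if_splits)
    then show ?thesis using that P by simp
  qed
  have choose: "\<exists>c. c ` {..<k} \<subseteq> {z \<in> X. \<not> cut_vertex ?V E z} \<and> (\<forall>K\<in>\<K>. K \<inter> c ` {..<k} \<noteq> {})"
    if \<K>: "\<K> \<subseteq> ends ?V E" "card \<K> \<le> k" "\<And>K. K \<in> \<K> \<Longrightarrow> K \<inter> X \<noteq> {}" and z: "z \<in> X" "\<not> cut_vertex ?V E z"
    for \<K> X z
  proof -
    let ?Y = "{z \<in> X. \<not> cut_vertex ?V E z}"
    have "\<forall>K\<in>\<K>. \<exists>s. s \<in> K \<inter> X" using \<K>(3) by blast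
    then obtain s where s: "\<And>K. K \<in> \<K> \<Longrightarrow> s K \<in> K \<inter> X" by metis
    have "finite \<K>" using \<K>(1) finE by (rule finite_subset)
    moreover have "s ` \<K> \<subseteq> ?Y" using s \<K>(1) end_not_cut_vertex[OF fin conn] by blast
    moreover have "card (s ` \<K>) \<le> k" using card_image_le[OF \<open>finite \<K>\<close>, of s] \<K>(2) by linarith
    moreover have "?Y \<noteq> {}" using z by blast
    ultimately have "\<exists>c :: nat \<Rightarrow> 'a. range c \<subseteq> ?Y \<and> s ` \<K> \<subseteq> c ` {..<k}"
      by (intro enumerate_covering) auto
    then obtain c where "range c \<subseteq> ?Y" "s ` \<K> \<subseteq> c ` {..<k}" by blast
    then show ?thesis using s by (intro exI[of _ c]) blast
  qed
  have PA: "K \<inter> A \<noteq> {}" if "K \<in> P" for K using that P(2) end_subset by fast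
  have QB: "K \<inter> B \<noteq> {}" if "K \<in> ends ?V E - P" for K using that P(1) end_subset by fast
  have "P \<subseteq> ends ?V E" using P(2) by blast
  then have "\<exists>c. c ` {..<k} \<subseteq> {z \<in> A. \<not> cut_vertex ?V E z} \<and> (\<forall>K\<in>P. K \<inter> c ` {..<k} \<noteq> {})"
    by (intro choose[OF _ P(3) _ x] PA)
  then obtain a where a: "a ` {..<k} \<subseteq> {z \<in> A. \<not> cut_vertex ?V E z}" "\<forall>K\<in>P. K \<inter> a ` {..<k} \<noteq> {}"
    by (elim exE conjE)
  have "\<exists>c. c ` {..<k} \<subseteq> {z \<in> B. \<not> cut_vertex ?V E z} \<and>
      (\<forall>K\<in>ends ?V E - P. K \<inter> c ` {..<k} \<noteq> {})"
    by (intro choose[OF Diff_subset P(4) _ y] QB)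
  then obtain b where b: "b ` {..<k} \<subseteq> {z \<in> B. \<not> cut_vertex ?V E z}"
      "\<forall>K\<in>ends ?V E - P. K \<inter> b ` {..<k} \<noteq> {}"
    by (elim exE conjE)
  have hit: "K \<inter> (a ` {..<k} \<union> b ` {..<k}) \<noteq> {}" if "K \<in> ends ?V E" for K
    using that a(2) b(2) by (cases "K \<in> P") (auto simp: Int_Un_distrib)
  have "\<exists>c. c ` {..<k} = b ` {..<k} \<and> robustly_connected ?V (E \<union> pairing k a c)"
    using fin conn few
  proof (rule robust_pairing_noncut)
    show "C \<inter> (a ` {..<k} \<union> b ` {..<k}) \<noteq> {}"
      if "cut_vertex ?V E v" "C \<in> components (?V - {v}) E" for v C
      using hits_component[OF fin hit that] by blast
    show "a i \<in> ?V \<and> \<not> cut_vertex ?V E (a i)" if "i < k" for i using a(1) that by auto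
    show "b i \<in> ?V \<and> \<not> cut_vertex ?V E (b i)" if "i < k" for i using b(1) that by auto
  qed
  then obtain c where "c ` {..<k} = b ` {..<k}" "robustly_connected ?V (E \<union> pairing k a c)" by blast
  moreover have "a ` {..<k} \<subseteq> A" "b ` {..<k} \<subseteq> B" using a(1) b(1) by auto
  ultimately show ?thesis by metis
qed

text \<open>Ends contain no cut vertices, so all of them lie in \<open>A\<close>; their number is at
  most \<open>k\<close> and the \<open>A\<close>-endpoints alone can hit them.\<close>

lemma robust_pairing_exists_free:
  fixes V :: "'a set"
  assumes fin: "finite V" and conn: "connected_graph V E"
    and few: "\<And>v. cut_vertex V E v \<Longrightarrow> card (components (V - {v}) E) \<le> k + 1"
    and V: "V = A \<union> B" and allcut: "\<And>y. y \<in> B \<Longrightarrow> cut_vertex V E y" and B: "2 \<le> card B"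
    and kA: "card {K \<in> ends V E. K \<subseteq> A} \<le> k"
  shows "\<exists>a b. a ` {..<k} \<subseteq> A \<and> b ` {..<k} \<subseteq> B \<and> robustly_connected V (E \<union> pairing k a b)"
proof -
  have ends_A: "K \<subseteq> A" if "K \<in> ends V E" for K
    using end_subset[OF that] end_not_cut_vertex[OF fin conn that] allcut V by blast
  then have all: "{K \<in> ends V E. K \<subseteq> A} = ends V E" by blast
  have finE: "finite (ends V E)"
    by (rule finite_subset[of _ "Pow V"]) (use end_subset fin in auto)
  have "\<forall>K\<in>ends V E. \<exists>s. s \<in> K" using end_nonempty by blast
  then obtain s where s: "\<And>K. K \<in> ends V E \<Longrightarrow> s K \<in> K" by metis
  let ?Y = "{z \<in> A. \<not> cut_vertex V E z}"
  have sub: "s ` ends V E \<subseteq> ?Y" using s ends_A end_not_cut_vertex[OF fin conn] by blast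
  have "ends V E \<noteq> {}"
  proof -
    obtain v where v: "v \<in> B" using B by (metis card.empty ex_in_conv not_numeral_le_zero)
    have "v \<in> V" using v V by blast
    then obtain z where "z \<in> V - {v}" using allcut[OF v] cut_vertex_iff[OF fin conn] by blast
    then show ?thesis using end_below[OF fin allcut[OF v] component_of_mem] by blast
  qed
  then have "?Y \<noteq> {}" using sub by blast
  moreover have "card (s ` ends V E) \<le> k" using card_image_le[OF finE, of s] kA all by simp
  ultimately have "\<exists>a :: nat \<Rightarrow> 'a. range a \<subseteq> ?Y \<and> s ` ends V E \<subseteq> a ` {..<k}"
    using finE by (intro enumerate_covering sub) auto
  then obtain a where a: "range a \<subseteq> ?Y" "s ` ends V E \<subseteq> a ` {..<k}" by blast
  have hit: "K \<inter> a ` {..<k} \<noteq> {}" if "K \<in> ends V E" for K using s[OF that] a(2) that by blast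
  have "\<exists>b. b ` {..<k} \<subseteq> B \<and> robustly_connected V (E \<union> pairing k a b)"
    using fin conn few
  proof (rule robust_pairing_free)
    show "C \<inter> a ` {..<k} \<noteq> {}" if "cut_vertex V E v" "C \<in> components (V - {v}) E" for v C
      using hits_component[OF fin hit that] by blast
  qed (use a(1) V B in auto)
  then show ?thesis using a(1) by blast
qed

lemma pairing_converse: "pairing k b a = (pairing k a b)\<inverse>"
  by (auto simp: pairing_def)

lemma robustly_connected_converse: "robustly_connected V (E \<union> F\<inverse>) = robustly_connected V (E \<union> F)"
  by (simp add: robustly_connected_def same_component_converse)

theorem theorem3:
  fixes A B :: "'a set" and E :: "('a \<times> 'a) set"
  assumes "bipartite_graph A B E"
    and "connected_graph (A \<union> B) E"
    and "card A \<ge> 2" and "card B \<ge> 2"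
  shows "int (min_biconnector_size A B E) \<le> eta A B E"
proof -
  let ?V = "A \<union> B"
  define k where "k = nat (eta A B E)"
  have fin: "finite ?V" "finite (A \<times> B)" and AB: "A \<inter> B = {}"
    using assms(1) by (auto simp: bipartite_graph_def)
  note bounds = eta_ge_ends[OF assms(1,2)]
  have k: "int k = eta A B E" using bounds(4) by (simp add: k_def)
  have kA: "card {K \<in> ends ?V E. K \<subseteq> A} \<le> k" and kB: "card {K \<in> ends ?V E. K \<subseteq> B} \<le> k"
    and kAB: "card (ends ?V E) \<le> 2 * k"
    using bounds k by linarith+
  have few: "card (components (?V - {v}) E) \<le> k + 1" if "cut_vertex ?V E v" for v
    using eta_ge_split[OF fin(1) assms(2) that] k by linarith
  have "\<exists>a b. a ` {..<k} \<subseteq> A \<and> b ` {..<k} \<subseteq> B \<and> robustly_connected ?V (E \<union> pairing k a b)"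
  proof (cases "\<exists>y\<in>B. \<not> cut_vertex ?V E y")
    case False
    then show ?thesis
      using robust_pairing_exists_free[OF fin(1) assms(2) few refl _ assms(4) kA] by blast
  next
    case yB: True
    show ?thesis
    proof (cases "\<exists>x\<in>A. \<not> cut_vertex ?V E x")
      case True
      then show ?thesis
        using yB robust_pairing_exists_noncut[OF assms(1,2) few _ _ _ _ kA kB kAB] by blast
    next
      \<comment> \<open>Now all of \<open>A\<close> consists of cut vertices: the sides exchange
        roles, and the resulting pairs are reversed afterwards.\<close>
      case False
      then obtain b a where "b ` {..<k} \<subseteq> B" "a ` {..<k} \<subseteq> A"
          "robustly_connected ?V (E \<union> pairing k b a)"
        using robust_pairing_exists_free[OF fin(1) assms(2) few Un_commute _ assms(3) kB] by blast
      then show ?thesis by (metis pairing_converse robustly_connected_converse)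
    qed
  qed
  then obtain a b where ab: "a ` {..<k} \<subseteq> A" "b ` {..<k} \<subseteq> B"
      "robustly_connected ?V (E \<union> pairing k a b)" by blast
  let ?L = "pairing k a b - E"
  have "2 < card ?V" using assms(3,4) fin AB by (simp add: card_Un_disjoint)
  moreover have "pairing k a b \<subseteq> A \<times> B" using ab by (auto simp: pairing_def)
  ultimately have L: "biconnector A B E ?L"
    using ab(3) by (intro biconnector_of_robust[OF assms(1,2)])
  have "{L. biconnector A B E L} \<subseteq> Pow (A \<times> B)" by (auto simp: biconnector_def)
  then have "finite {L. biconnector A B E L}" using fin(2) by (meson finite_Pow_iff finite_subset)
  then have "min_biconnector_size A B E \<le> card ?L"
    unfolding min_biconnector_size_def using L by (intro Min_le) auto
  \<comment> \<open>Pairs may coincide or already belong to \<open>E\<close>, so only inequalities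
    hold here.\<close>
  also have "\<dots> \<le> card (pairing k a b)" by (rule card_mono) (auto simp: pairing_def)
  also have "\<dots> \<le> k" unfolding pairing_def using card_image_le[of "{..<k}"] by simp
  finally show ?thesis using k by linarith
qed

end
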